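(* For every odd positive integer $d$ and every positive integer $n$ there exists $N$ such that the following holds. For every continuous family $\{F_V\}$ of odd polynomial functions $F_V:V\to\mathbf{R}$ of degree at most $d$, where $V$ ranges over all $n$-dimensional linear subspaces of $\mathbf{R}^N$, there exists an $n$-dimensional linear subspace $V\subset\mathbf{R}^N$ such that $F_V\equiv 0$.
   Context: A polynomial function $F$ on a vector space is odd if $F(-x)=-F(x)$, i.e. it is a sum of homogeneous polynomials of odd degrees. The family $\{F_V\}$ is continuous if it is a continuous section, over the Grassmannian $G(n,N)$ of (unoriented) $n$-dimensional linear subspaces of $\mathbf{R}^N$, of the vector bundle whose fiber over $V$ is the space of odd polynomials of degree at most $d$ on $V$. *)

theory Defs
  imports "HOL-Analysis.Analysis" "HOL-Library.Function_Algebras"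
begin

text \<open>
  The space $\mathbf{R}^N$ is the carrier of the library's \<^const>\<open>Euclidean_space\<close> topology,
  i.e. the functions \<^typ>\<open>nat \<Rightarrow> real\<close> that vanish from index \<open>N\<close> on.  The pointwise vector
  space structure makes \<^const>\<open>subspace\<close>, \<^const>\<open>dim\<close> and \<^const>\<open>span\<close> available there.
\<close>

instantiation "fun" :: (type, real_vector) real_vector
begin

definition scaleR_fun :: "real \<Rightarrow> ('a \<Rightarrow> 'b) \<Rightarrow> 'a \<Rightarrow> 'b"
  where "scaleR_fun r f = (\<lambda>x. r *\<^sub>R f x)"

instance
  by standard (simp_all add: scaleR_fun_def fun_eq_iff scaleR_add_right scaleR_add_left)

end

abbreviation Rn :: "nat \<Rightarrow> (nat \<Rightarrow> real) set"
  where "Rn N \<equiv> topspace (Euclidean_space N)"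

definition subspaces :: "nat \<Rightarrow> nat \<Rightarrow> (nat \<Rightarrow> real) set set"
  where "subspaces n N = {V. subspace V \<and> V \<subseteq> Rn N \<and> dim V = n}"

definition multi_indices :: "nat \<Rightarrow> nat \<Rightarrow> (nat \<Rightarrow> nat) set"
  where "multi_indices d N = {\<alpha>. (\<forall>i\<ge>N. \<alpha> i = 0) \<and> (\<Sum>i<N. \<alpha> i) \<le> d}"

text \<open>For a subspace \<open>V \<subseteq> Rn N\<close>, restrictions of ambient polynomials of degree at most \<open>d\<close> are
  the same as polynomials of degree at most \<open>d\<close> in linear coordinates of \<open>V\<close>.\<close>

definition polynomial_on :: "nat \<Rightarrow> nat \<Rightarrow> (nat \<Rightarrow> real) set \<Rightarrow> ((nat \<Rightarrow> real) \<Rightarrow> real) \<Rightarrow> bool"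
  where "polynomial_on d N V f \<longleftrightarrow>
    (\<exists>c. \<forall>x\<in>V. f x = (\<Sum>\<alpha>\<in>multi_indices d N. c \<alpha> * (\<Prod>i<N. x i ^ \<alpha> i)))"

text \<open>Functions on \<open>V\<close> are normalised by \<^const>\<open>extensional\<close>, so that equality of elements is
  equality of functions on \<open>V\<close>.\<close>

definition odd_polynomials :: "nat \<Rightarrow> nat \<Rightarrow> (nat \<Rightarrow> real) set \<Rightarrow> ((nat \<Rightarrow> real) \<Rightarrow> real) set"
  where "odd_polynomials d N V =
    {f \<in> extensional V. polynomial_on d N V f \<and> (\<forall>x\<in>V. f (- x) = - f x)}"

text \<open>On this finite-dimensional space of functions, the topology of pointwise convergence is a
  Hausdorff vector space topology, hence the usual one.\<close>

definition odd_polynomial_topology :: "nat \<Rightarrow> nat \<Rightarrow> ((nat \<Rightarrow> real) \<Rightarrow> real) topology"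
  where "odd_polynomial_topology d n =
    subtopology (product_topology (\<lambda>_. euclideanreal) (Rn n)) (odd_polynomials d n (Rn n))"

definition quotient_topology :: "'a topology \<Rightarrow> ('a \<Rightarrow> 'b) \<Rightarrow> 'b topology"
  where "quotient_topology X q =
    topology (\<lambda>U. U \<subseteq> q ` topspace X \<and> openin X {x \<in> topspace X. q x \<in> U})"

definition frames :: "nat \<Rightarrow> nat \<Rightarrow> (nat \<Rightarrow> nat \<Rightarrow> real) set"
  where "frames n N =
    {v \<in> {..<n} \<rightarrow>\<^sub>E Rn N. inj_on v {..<n} \<and> independent (v ` {..<n})}"

definition stiefel :: "nat \<Rightarrow> nat \<Rightarrow> (nat \<Rightarrow> nat \<Rightarrow> real) topology"
  where "stiefel n N = subtopology (product_topology (\<lambda>_. Euclidean_space N) {..<n}) (frames n N)"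

definition frame_span :: "nat \<Rightarrow> (nat \<Rightarrow> nat \<Rightarrow> real) \<Rightarrow> (nat \<Rightarrow> real) set"
  where "frame_span n v = span (v ` {..<n})"

definition grassmannian :: "nat \<Rightarrow> nat \<Rightarrow> (nat \<Rightarrow> real) set topology"
  where "grassmannian n N = quotient_topology (stiefel n N) (frame_span n)"

definition frame_map :: "nat \<Rightarrow> (nat \<Rightarrow> nat \<Rightarrow> real) \<Rightarrow> (nat \<Rightarrow> real) \<Rightarrow> nat \<Rightarrow> real"
  where "frame_map n v t = (\<Sum>i<n. t i *\<^sub>R v i)"

text \<open>A frame \<open>v\<close> identifies \<open>Rn n\<close> with its span and so transports an odd polynomial \<open>p\<close> on
  \<open>Rn n\<close> to one on that span.  The bundle of odd polynomials is the bundle associated with the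
  frame bundle in this way: its points are pairs \<open>(V, f)\<close> with \<open>f\<close> an odd polynomial of degree at
  most \<open>d\<close> on \<open>V\<close>, and it is a topological quotient of the space of all pairs \<open>(v, p)\<close>.\<close>

definition frame_transport ::
  "nat \<Rightarrow> (nat \<Rightarrow> nat \<Rightarrow> real) \<times> ((nat \<Rightarrow> real) \<Rightarrow> real) \<Rightarrow> (nat \<Rightarrow> real) set \<times> ((nat \<Rightarrow> real) \<Rightarrow> real)"
  where "frame_transport n = (\<lambda>(v, p).
    (frame_span n v,
     restrict (\<lambda>x. p (inv_into (Rn n) (frame_map n v) x)) (frame_span n v)))"

definition odd_polynomial_bundle ::
  "nat \<Rightarrow> nat \<Rightarrow> nat \<Rightarrow> ((nat \<Rightarrow> real) set \<times> ((nat \<Rightarrow> real) \<Rightarrow> real)) topology"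
  where "odd_polynomial_bundle d n N =
    quotient_topology (prod_topology (stiefel n N) (odd_polynomial_topology d n)) (frame_transport n)"

definition continuous_odd_polynomial_family ::
  "nat \<Rightarrow> nat \<Rightarrow> nat \<Rightarrow> ((nat \<Rightarrow> real) set \<Rightarrow> (nat \<Rightarrow> real) \<Rightarrow> real) \<Rightarrow> bool"
  where "continuous_odd_polynomial_family d n N F \<longleftrightarrow>
    (\<forall>V\<in>subspaces n N. F V \<in> odd_polynomials d N V) \<and>
    continuous_map (grassmannian n N) (odd_polynomial_bundle d n N) (\<lambda>V. (V, F V))"

lemma quotient_map_quotient_topology: "quotient_map X (quotient_topology X q) q"
proof -
  have "istopology (\<lambda>U. U \<subseteq> q ` topspace X \<and> openin X {x \<in> topspace X. q x \<in> U})"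
  proof -
    have 1: "{x \<in> topspace X. q x \<in> S \<inter> T} = {x \<in> topspace X. q x \<in> S} \<inter> {x \<in> topspace X. q x \<in> T}"
      for S T by auto
    have 2: "{x \<in> topspace X. q x \<in> \<Union>K} = (\<Union>S\<in>K. {x \<in> topspace X. q x \<in> S})" for K by auto
    show ?thesis
      unfolding istopology_def 1 2 by (auto intro!: openin_Union)
  qed
  hence op: "openin (quotient_topology X q) U \<longleftrightarrow>
      U \<subseteq> q ` topspace X \<and> openin X {x \<in> topspace X. q x \<in> U}" for U
    unfolding quotient_topology_def by (simp add: topology_inverse')
  have "{x \<in> topspace X. q x \<in> q ` topspace X} = topspace X" by auto
  hence "topspace (quotient_topology X q) = q ` topspace X"
    unfolding topspace_def[of "quotient_topology X q"] op by auto
  thus ?thesis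
    unfolding quotient_map_def op by auto
qed

lemma topspace_quotient_topology: "topspace (quotient_topology X q) = q ` topspace X"
  using quotient_map_quotient_topology[of X q] unfolding quotient_map_def by metis

lemma finite_multi_indices: "finite (multi_indices d N)"
proof -
  have "inj_on (\<lambda>\<alpha>. restrict \<alpha> {..<N}) (multi_indices d N)"
    unfolding inj_on_def multi_indices_def
    by (simp add: fun_eq_iff restrict_def) (metis not_le)
  moreover have "(\<lambda>\<alpha>. restrict \<alpha> {..<N}) ` multi_indices d N \<subseteq> {..<N} \<rightarrow>\<^sub>E {..d}"
  proof -
    have "\<alpha> i \<le> d" if "sum \<alpha> {..<N} \<le> d" "i < N" for \<alpha> i
      using that member_le_sum[of i "{..<N}" \<alpha>] by force
    thus ?thesis by (auto simp: multi_indices_def PiE_iff extensional_def split: if_splits)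
  qed
  ultimately show ?thesis
    by (meson finite_PiE finite_atMost finite_imageD finite_lessThan finite_subset)
qed

lemma sum_fun_apply: "(\<Sum>a\<in>A. f a) x = (\<Sum>a\<in>A. f a x)"
  for f :: "'a \<Rightarrow> 'b \<Rightarrow> 'c::comm_monoid_add"
  by (induction A rule: infinite_finite_induct) auto

lemma scaleR_fun_apply: "(r *\<^sub>R f) x = r *\<^sub>R f x"
  by (simp add: scaleR_fun_def)

lemma subspace_Rn: "subspace (Rn N)"
  by (simp add: subspace_def topspace_Euclidean_space scaleR_fun_apply)

definition unit_vec :: "nat \<Rightarrow> nat \<Rightarrow> real"
  where "unit_vec j = (\<lambda>i. if i = j then 1 else 0)"

lemma Rn_expansion:
  assumes "x \<in> Rn N"
  shows "x = (\<Sum>j<N. x j *\<^sub>R unit_vec j)"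
proof
  fix i
  have "(\<Sum>j<N. x j *\<^sub>R unit_vec j) i = (\<Sum>j<N. if i = j then x j else 0)"
    unfolding sum_fun_apply by (intro sum.cong) (auto simp: scaleR_fun_apply unit_vec_def)
  also have "\<dots> = x i"
    using assms by (auto simp: topspace_Euclidean_space)
  finally show "x i = (\<Sum>j<N. x j *\<^sub>R unit_vec j) i" ..
qed

lemma Rn_subset_span: "Rn N \<subseteq> span (unit_vec ` {..<N})"
proof
  fix x assume "x \<in> Rn N"
  have "(\<Sum>j<N. x j *\<^sub>R unit_vec j) \<in> span (unit_vec ` {..<N})"
    by (intro span_sum span_scale span_base) auto
  with Rn_expansion[OF \<open>x \<in> Rn N\<close>] show "x \<in> span (unit_vec ` {..<N})" by simp
qed

lemma topspace_stiefel: "topspace (stiefel n N) = frames n N"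
  by (auto simp: stiefel_def frames_def)

lemma frame_span_in_subspaces:
  assumes "v \<in> frames n N"
  shows "frame_span n v \<in> subspaces n N"
proof -
  have v: "v ` {..<n} \<subseteq> Rn N" "inj_on v {..<n}" "independent (v ` {..<n})"
    using assms by (auto simp: frames_def PiE_iff simp del: topspace_Euclidean_space)
  have "frame_span n v \<subseteq> Rn N"
    unfolding frame_span_def using v(1) subspace_Rn by (rule span_minimal)
  moreover have "dim (frame_span n v) = n"
    unfolding frame_span_def using v(2,3) by (simp add: dim_eq_card_independent card_image)
  ultimately show ?thesis
    by (simp add: subspaces_def frame_span_def subspace_span)
qed

lemma subspaces_frame:
  assumes "V \<in> subspaces n N"
  obtains v where "v \<in> frames n N" "frame_span n v = V"
proof -
  have V: "subspace V" "V \<subseteq> Rn N" "dim V = n"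
    using assms by (auto simp: subspaces_def)
  obtain B where B: "B \<subseteq> V" "independent B" "V \<subseteq> span B" "card B = n"
    using basis_exists[of V] V(3) by metis
  have "finite B"
    using B V Rn_subset_span[of N] independent_span_bound[of "unit_vec ` {..<N}" B] by force
  then obtain h where h: "bij_betw h {..<n} B"
    using ex_bij_betw_nat_finite[of B] B(4) by (auto simp: atLeast0LessThan)
  define v where "v = restrict h {..<n}"
  have im: "v ` {..<n} = B" and inj: "inj_on v {..<n}"
    using h by (auto simp: v_def bij_betw_def inj_on_def)
  have "v \<in> {..<n} \<rightarrow>\<^sub>E Rn N"
    using im B(1) V(2) by (auto simp: v_def simp del: topspace_Euclidean_space)
  hence "v \<in> frames n N"
    using im inj B by (simp add: frames_def)
  moreover have "frame_span n v = V"
    unfolding frame_span_def im using B(1,3) V(1) by (simp add: span_subspace)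
  ultimately show ?thesis by (rule that)
qed

lemma topspace_grassmannian: "topspace (grassmannian n N) = subspaces n N"
  unfolding grassmannian_def topspace_quotient_topology topspace_stiefel
  using frame_span_in_subspaces subspaces_frame by (auto simp: image_iff) metis

lemma polynomial_on_cong:
  "(\<And>x. x \<in> V \<Longrightarrow> f x = g x) \<Longrightarrow> polynomial_on d N V f \<longleftrightarrow> polynomial_on d N V g"
  by (simp add: polynomial_on_def)

lemma polynomial_on_monomial:
  assumes "\<alpha> \<in> multi_indices d N"
  shows "polynomial_on d N V (\<lambda>x. \<Prod>i<N. x i ^ \<alpha> i)"
  unfolding polynomial_on_def
  by (rule exI[of _ "\<lambda>\<beta>. if \<beta> = \<alpha> then 1 else 0"])
     (use assms finite_multi_indices in \<open>simp add: if_distrib[of "\<lambda>x. x * _"] cong: if_cong\<close>)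

lemma polynomial_on_add:
  assumes "polynomial_on d N V f" "polynomial_on d N V g"
  shows "polynomial_on d N V (\<lambda>x. f x + g x)"
proof -
  obtain a b where "\<forall>x\<in>V. f x = (\<Sum>\<alpha>\<in>multi_indices d N. a \<alpha> * (\<Prod>i<N. x i ^ \<alpha> i))"
    "\<forall>x\<in>V. g x = (\<Sum>\<alpha>\<in>multi_indices d N. b \<alpha> * (\<Prod>i<N. x i ^ \<alpha> i))"
    using assms unfolding polynomial_on_def by auto
  thus ?thesis unfolding polynomial_on_def
    by (intro exI[of _ "\<lambda>\<alpha>. a \<alpha> + b \<alpha>"]) (simp add: distrib_right sum.distrib)
qed

lemma polynomial_on_cmult:
  assumes "polynomial_on d N V f"
  shows "polynomial_on d N V (\<lambda>x. c * f x)"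
proof -
  obtain a where "\<forall>x\<in>V. f x = (\<Sum>\<alpha>\<in>multi_indices d N. a \<alpha> * (\<Prod>i<N. x i ^ \<alpha> i))"
    using assms unfolding polynomial_on_def by auto
  thus ?thesis unfolding polynomial_on_def
    by (intro exI[of _ "\<lambda>\<alpha>. c * a \<alpha>"]) (simp add: sum_distrib_left mult.assoc)
qed

lemma polynomial_on_sum:
  assumes "\<And>i. i \<in> I \<Longrightarrow> polynomial_on d N V (f i)"
  shows "polynomial_on d N V (\<lambda>x. \<Sum>i\<in>I. f i x)"
  using assms
proof (induction I rule: infinite_finite_induct)
  case (insert i I)
  thus ?case by (simp add: polynomial_on_add)
qed (auto simp: polynomial_on_def intro!: exI[of _ "\<lambda>_. 0"])

lemma polynomial_on_mono:
  assumes "polynomial_on d N V f" "d \<le> e"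
  shows "polynomial_on e N V f"
proof -
  obtain a where a: "\<forall>x\<in>V. f x = (\<Sum>\<alpha>\<in>multi_indices d N. a \<alpha> * (\<Prod>i<N. x i ^ \<alpha> i))"
    using assms unfolding polynomial_on_def by auto
  have "polynomial_on e N V (\<lambda>x. \<Sum>\<alpha>\<in>multi_indices d N. a \<alpha> * (\<Prod>i<N. x i ^ \<alpha> i))"
    using \<open>d \<le> e\<close>
    by (intro polynomial_on_sum polynomial_on_cmult polynomial_on_monomial)
       (auto simp: multi_indices_def)
  thus ?thesis using a polynomial_on_cong[of V f] by simp
qed

lemma polynomial_on_mult:
  assumes "polynomial_on d N V f" "polynomial_on e N V g"
  shows "polynomial_on (d + e) N V (\<lambda>x. f x * g x)"
proof -
  obtain a where a: "\<forall>x\<in>V. f x = (\<Sum>\<alpha>\<in>multi_indices d N. a \<alpha> * (\<Prod>i<N. x i ^ \<alpha> i))"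
    using assms(1) unfolding polynomial_on_def by auto
  obtain b where b: "\<forall>x\<in>V. g x = (\<Sum>\<alpha>\<in>multi_indices e N. b \<alpha> * (\<Prod>i<N. x i ^ \<alpha> i))"
    using assms(2) unfolding polynomial_on_def by auto
  have "polynomial_on (d + e) N V (\<lambda>x. \<Sum>\<alpha>\<in>multi_indices d N. \<Sum>\<beta>\<in>multi_indices e N.
      (a \<alpha> * b \<beta>) * (\<Prod>i<N. x i ^ (\<alpha> i + \<beta> i)))"
    by (intro polynomial_on_sum polynomial_on_cmult polynomial_on_monomial)
       (auto simp: multi_indices_def sum.distrib)
  moreover have "f x * g x = (\<Sum>\<alpha>\<in>multi_indices d N. \<Sum>\<beta>\<in>multi_indices e N.
      (a \<alpha> * b \<beta>) * (\<Prod>i<N. x i ^ (\<alpha> i + \<beta> i)))" if "x \<in> V" for x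
    using a b that by (simp add: sum_product power_add prod.distrib mult_ac)
  ultimately show ?thesis
    using polynomial_on_cong[of V "\<lambda>x. f x * g x"] by simp
qed

lemma polynomial_on_const: "polynomial_on 0 N V (\<lambda>_. c)"
proof -
  have "polynomial_on 0 N V (\<lambda>x. c * (\<Prod>i<N. x i ^ (\<lambda>_. 0) i))"
    by (intro polynomial_on_cmult polynomial_on_monomial) (simp add: multi_indices_def)
  thus ?thesis by simp
qed

lemma polynomial_on_power:
  assumes "polynomial_on d N V f"
  shows "polynomial_on (d * k) N V (\<lambda>x. f x ^ k)"
  by (induction k) (use polynomial_on_mult[OF assms] in \<open>simp_all add: polynomial_on_const\<close>)

lemma polynomial_on_prod:
  assumes "finite I" "\<And>i. i \<in> I \<Longrightarrow> polynomial_on (e i) N V (f i)"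
  shows "polynomial_on (\<Sum>i\<in>I. e i) N V (\<lambda>x. \<Prod>i\<in>I. f i x)"
  using assms by (induction I) (auto intro: polynomial_on_const polynomial_on_mult)

lemma polynomial_on_coordinate:
  assumes "j < N"
  shows "polynomial_on 1 N V (\<lambda>x. x j)"
proof -
  have "polynomial_on 1 N V (\<lambda>x. \<Prod>i<N. x i ^ (if i = j then 1 else 0))"
    using assms by (intro polynomial_on_monomial) (auto simp: multi_indices_def)
  moreover have "(\<Prod>i<N. x i ^ (if i = j then 1 else 0)) = (x j :: real)" for x
    using assms by (simp add: if_distrib[of "\<lambda>k. _ ^ k"] cong: if_cong)
  ultimately show ?thesis by simp
qed

lemma polynomial_on_linear_substitution:
  assumes "polynomial_on d M W p" "\<And>x. x \<in> V \<Longrightarrow> g x \<in> W"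
    and "\<And>i. i < M \<Longrightarrow> polynomial_on 1 N V (\<lambda>x. g x i)"
  shows "polynomial_on d N V (\<lambda>x. p (g x))"
proof -
  obtain a where a: "\<forall>x\<in>W. p x = (\<Sum>\<alpha>\<in>multi_indices d M. a \<alpha> * (\<Prod>i<M. x i ^ \<alpha> i))"
    using assms(1) unfolding polynomial_on_def by auto
  have "polynomial_on d N V (\<lambda>x. \<Prod>i<M. g x i ^ \<alpha> i)" if "\<alpha> \<in> multi_indices d M" for \<alpha>
  proof (rule polynomial_on_mono)
    show "polynomial_on (\<Sum>i<M. 1 * \<alpha> i) N V (\<lambda>x. \<Prod>i<M. g x i ^ \<alpha> i)"
      by (intro polynomial_on_prod polynomial_on_power assms) auto
    show "(\<Sum>i<M. 1 * \<alpha> i) \<le> d" using that by (simp add: multi_indices_def)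
  qed
  hence "polynomial_on d N V (\<lambda>x. \<Sum>\<alpha>\<in>multi_indices d M. a \<alpha> * (\<Prod>i<M. g x i ^ \<alpha> i))"
    by (intro polynomial_on_sum polynomial_on_cmult)
  thus ?thesis
    using a assms(2) polynomial_on_cong[of V "\<lambda>x. p (g x)"] by simp
qed

lemma linear_frame_map: "linear (frame_map n v)"
  by (rule linearI)
     (simp_all add: frame_map_def scaleR_fun_apply scaleR_add_left sum.distrib scaleR_sum_right)

lemma bij_betw_frame_map:
  assumes "v \<in> frames n N"
  shows "bij_betw (frame_map n v) (Rn n) (frame_span n v)"
proof -
  have inj: "inj_on v {..<n}" and ind: "independent (v ` {..<n})"
    using assms by (auto simp: frames_def)
  have "inj_on (frame_map n v) (Rn n)"
    unfolding linear_injective_on_subspace_0[OF linear_frame_map subspace_Rn]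
  proof (intro ballI impI)
    fix t assume t: "t \<in> Rn n" "frame_map n v t = 0"
    have "(\<Sum>w\<in>v ` {..<n}. t (the_inv_into {..<n} v w) *\<^sub>R w) = 0"
      using t(2) inj by (simp add: sum.reindex frame_map_def the_inv_into_f_f)
    hence "t (the_inv_into {..<n} v w) = 0" if "w \<in> v ` {..<n}" for w
      using independentD[OF ind _ subset_refl, of "\<lambda>w. t (the_inv_into {..<n} v w)" w] that by simp
    hence "t i = 0" if "i < n" for i
      using that inj by (force simp: the_inv_into_f_f)
    with t(1) show "t = 0"
      by (auto simp: topspace_Euclidean_space fun_eq_iff) (metis not_le)
  qed
  moreover have "frame_map n v ` Rn n = frame_span n v"
  proof
    show "frame_map n v ` Rn n \<subseteq> frame_span n v"
      unfolding frame_map_def frame_span_def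
      by (intro image_subsetI span_sum span_scale) (simp add: span_base)
    have "v i = frame_map n v (unit_vec i)" if "i < n" for i
    proof -
      have "frame_map n v (unit_vec i) = (\<Sum>j<n. if i = j then v j else 0)"
        unfolding frame_map_def by (intro sum.cong) (auto simp: unit_vec_def)
      with that show ?thesis by simp
    qed
    hence "v ` {..<n} \<subseteq> frame_map n v ` Rn n"
      by (force simp: topspace_Euclidean_space unit_vec_def)
    thus "frame_span n v \<subseteq> frame_map n v ` Rn n"
      unfolding frame_span_def
      by (intro span_minimal linear_subspace_image linear_frame_map subspace_Rn)
  qed
  ultimately show ?thesis by (simp add: bij_betw_def)
qed

lemma topspace_odd_polynomial_topology:
  "topspace (odd_polynomial_topology d n) = odd_polynomials d n (Rn n)"
  by (auto simp: odd_polynomial_topology_def odd_polynomials_def PiE_iff extensional_def)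

lemma polynomial_on_linear:
  assumes "linear f" "V \<subseteq> Rn N"
  shows "polynomial_on 1 N V (\<lambda>x. f x i)"
proof -
  have "polynomial_on 1 N V (\<lambda>x. \<Sum>j<N. f (unit_vec j) i * x j)"
    by (intro polynomial_on_sum polynomial_on_cmult polynomial_on_coordinate) auto
  moreover have "f x i = (\<Sum>j<N. f (unit_vec j) i * x j)" if "x \<in> V" for x
  proof -
    have "f x = f (\<Sum>j<N. x j *\<^sub>R unit_vec j)"
      using Rn_expansion that assms(2) by (metis subsetD)
    also have "\<dots> = (\<Sum>j<N. x j *\<^sub>R f (unit_vec j))"
      by (simp add: linear_sum[OF assms(1)] linear_scale[OF assms(1)])
    finally show ?thesis by (simp add: sum_fun_apply scaleR_fun_apply mult.commute)
  qed
  ultimately show ?thesis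
    using polynomial_on_cong[of V "\<lambda>x. f x i"] by simp
qed

lemma topspace_odd_polynomial_bundle:
  "topspace (odd_polynomial_bundle d n N) = (SIGMA V:subspaces n N. odd_polynomials d N V)"
proof -
  have "frame_transport n (v, p) \<in> (SIGMA V:subspaces n N. odd_polynomials d N V)"
    if v: "v \<in> frames n N" and p: "p \<in> odd_polynomials d n (Rn n)" for v p
  proof -
    let ?V = "frame_span n v" and ?g = "inv_into (Rn n) (frame_map n v)"
    have V: "?V \<in> subspaces n N" by (rule frame_span_in_subspaces[OF v])
    hence sub: "subspace ?V" "?V \<subseteq> Rn N" by (auto simp: subspaces_def)
    note bij = bij_betw_frame_map[OF v]
    have g: "?g x \<in> Rn n" "frame_map n v (?g x) = x" if "x \<in> ?V" for x
      using bij that by (auto simp: bij_betw_def inv_into_into f_inv_into_f)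
    have "inj_on (frame_map n v) (span (Rn n))"
      using bij span_eq_iff[THEN iffD2, OF subspace_Rn, of n] by (simp only: bij_betw_def)
    then obtain h where h: "linear h" "\<And>t. t \<in> span (Rn n) \<Longrightarrow> h (frame_map n v t) = t"
      using linear_exists_left_inverse_on[OF linear_frame_map subspace_span, of n v "Rn n"] by blast
    have gh: "?g x = h x" if "x \<in> ?V" for x
      using g[OF that] h(2)[OF span_base, of "?g x"] by simp
    have "polynomial_on d N ?V (\<lambda>x. p (h x))"
    proof (rule polynomial_on_linear_substitution[where p = p and g = h])
      show "polynomial_on d n (Rn n) p" using p by (simp add: odd_polynomials_def)
      show "h x \<in> Rn n" if "x \<in> ?V" for x using g(1)[OF that] gh[OF that] by simp
      show "polynomial_on 1 N ?V (\<lambda>x. h x i)" for i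
        by (rule polynomial_on_linear[OF h(1) sub(2)])
    qed
    moreover have "p (h (- x)) = - p (h x)" if "x \<in> ?V" for x
      using p g(1)[OF that] gh[OF that] linear_neg[OF h(1), of x] by (simp add: odd_polynomials_def)
    ultimately have "restrict (\<lambda>x. p (?g x)) ?V \<in> odd_polynomials d N ?V"
      using gh polynomial_on_cong[of ?V "restrict (\<lambda>x. p (?g x)) ?V" "\<lambda>x. p (h x)" d N]
        subspace_neg[OF sub(1)]
      by (simp add: odd_polynomials_def)
    with V show ?thesis by (simp add: frame_transport_def)
  qed
  moreover have "(V, f) \<in> frame_transport n ` (frames n N \<times> odd_polynomials d n (Rn n))"
    if V: "V \<in> subspaces n N" and f: "f \<in> odd_polynomials d N V" for V f
  proof -
    obtain v where v: "v \<in> frames n N" "frame_span n v = V"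
      using subspaces_frame[OF V] .
    note bij = bij_betw_frame_map[OF v(1), unfolded v(2)]
    define p where "p = restrict (\<lambda>t. f (frame_map n v t)) (Rn n)"
    have fm: "frame_map n v t \<in> V" if "t \<in> Rn n" for t
      using bij that by (auto simp: bij_betw_def)
    have "polynomial_on d n (Rn n) (\<lambda>t. f (frame_map n v t))"
      by (rule polynomial_on_linear_substitution[where p = f and W = V and M = N])
         (use f fm polynomial_on_linear[OF linear_frame_map subset_refl] in
          \<open>simp_all add: odd_polynomials_def\<close>)
    hence "p \<in> odd_polynomials d n (Rn n)"
      using f fm subspace_neg[OF subspace_Rn] linear_neg[OF linear_frame_map]
        polynomial_on_cong[of "Rn n" p "\<lambda>t. f (frame_map n v t)" d n]
      by (simp add: odd_polynomials_def p_def)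
    moreover have "restrict (\<lambda>x. p (inv_into (Rn n) (frame_map n v) x)) V = f"
    proof
      fix x
      have "inv_into (Rn n) (frame_map n v) x \<in> Rn n \<and>
          frame_map n v (inv_into (Rn n) (frame_map n v) x) = x" if "x \<in> V"
        using bij that by (auto simp: bij_betw_def inv_into_into f_inv_into_f)
      thus "restrict (\<lambda>x. p (inv_into (Rn n) (frame_map n v) x)) V x = f x"
        using f by (cases "x \<in> V") (auto simp: p_def odd_polynomials_def extensional_def)
    qed
    ultimately show ?thesis
      using v by (intro image_eqI[of _ _ "(v, p)"]) (simp_all add: frame_transport_def)
  qed
  ultimately have "frame_transport n ` (frames n N \<times> odd_polynomials d n (Rn n)) =
      (SIGMA V:subspaces n N. odd_polynomials d N V)"
    by (intro equalityI subsetI; elim SigmaE imageE) simp_all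
  thus ?thesis
    by (simp only: odd_polynomial_bundle_def topspace_quotient_topology topspace_prod_topology
      topspace_stiefel topspace_odd_polynomial_topology)
qed

end

theory Submission
  imports Defs "HOL-Homology.Homology"
begin

text \<open>
  Let \<open>M = m + 1\<close>.  A unit vector \<open>x\<close> of \<open>Rn M\<close> has \<open>n\<close> orthonormal copies in the coordinate
  blocks of \<open>Rn (n * M)\<close>; they span a subspace \<open>V x = V (- x)\<close>, on which they form a frame
  that changes sign with \<open>x\<close>.  Written in this frame, the odd polynomial on \<open>V x\<close> becomes an odd
  polynomial on \<open>Rn n\<close> that is an odd function of \<open>x\<close>.  A polynomial of degree at most \<open>d\<close> on
  \<open>Rn n\<close> is determined by its values at finitely many points, and with \<open>m\<close> points the
  Borsuk-Ulam theorem on the \<open>m\<close>-sphere gives an \<open>x\<close> at which all these values vanish.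

  Borsuk-Ulam reduces to the fact that odd self-maps of spheres have odd degree.  If such a map
  preserves the equator, then its degree has the parity of the degree on the equator.  To arrange
  this, approximate the map by an odd Lipschitz map.  For reasons of dimension, its restriction to
  the equator misses a line \<open>(q, 1)\<close> through the origin; shear this line onto the polar axis, and
  push the image of the equator off the poles into the equator by an odd homotopy.
\<close>

subsection \<open>Maps into spheres\<close>

text \<open>Radial projection to the unit sphere, which also discards all coordinates beyond
  \<open>n\<close>. If the coordinates up to \<open>n\<close> all vanish, the value is 0, which is
  off the sphere; hence the nonvanishing hypotheses below.\<close>

definition sphere_normalize :: "nat \<Rightarrow> (nat \<Rightarrow> real) \<Rightarrow> nat \<Rightarrow> real"
  where "sphere_normalize n x = (\<lambda>i. if i \<le> n then x i / sqrt (\<Sum>j\<le>n. (x j)\<^sup>2) else 0)"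

text \<open>Passes from the product topology to the type class topology, where
  \<open>compact\<close>, \<open>continuous_on\<close> and the Stone-Weierstrass theorem
  apply.\<close>

lemma nsphere_eq_top_of_set:
  "nsphere n = top_of_set {x. (\<Sum>i\<le>n. (x i)\<^sup>2) = 1 \<and> (\<forall>i>n. x i = 0)}"
  by (simp add: nsphere euclidean_product_topology)

lemma topspace_nsphere:
  "topspace (nsphere n) = {x. (\<Sum>i\<le>n. (x i)\<^sup>2) = 1 \<and> (\<forall>i>n. x i = 0)}"
  by (simp add: nsphere_eq_top_of_set)

lemma continuous_map_nsphere_iff:
  "continuous_map (nsphere n) euclideanreal f \<longleftrightarrow> continuous_on (topspace (nsphere n)) f"
  unfolding nsphere_eq_top_of_set by simp

lemma uminus_in_nsphere: "x \<in> topspace (nsphere n) \<Longrightarrow> - x \<in> topspace (nsphere n)"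
  by (simp add: topspace_nsphere)

lemma abs_le_1_nsphere:
  assumes "x \<in> topspace (nsphere n)"
  shows "\<bar>x i\<bar> \<le> 1"
proof (cases "i \<le> n")
  case True
  have "(x i)\<^sup>2 \<le> (\<Sum>i\<le>n. (x i)\<^sup>2)"
    using True by (intro member_le_sum) auto
  with assms show ?thesis
    by (simp add: topspace_nsphere abs_square_le_1)
next
  case False
  with assms show ?thesis by (simp add: topspace_nsphere)
qed

text \<open>By Tychonoff a product of compact intervals is compact, and the sphere is closed in it.
  The factors \<open>{0}\<close> beyond index \<open>n\<close> encode the vanishing of those
  coordinates.\<close>

lemma compact_nsphere: "compact (topspace (nsphere n))"
proof -
  define I where "I = (\<lambda>i. if i \<le> n then {-1..1} else {0::real})"
  have "compactin (product_topology (\<lambda>_::nat. euclideanreal) UNIV) (PiE UNIV I)"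
    by (auto simp: compactin_PiE I_def)
  hence I: "compact (PiE UNIV I)"
    by (simp add: euclidean_product_topology)
  have "closed {x::nat \<Rightarrow> real. (\<Sum>i\<le>n. (x i)\<^sup>2) = 1}"
    by (intro closed_Collect_eq continuous_intros continuous_on_product_coordinates)
  moreover have "topspace (nsphere n) = PiE UNIV I \<inter> {x. (\<Sum>i\<le>n. (x i)\<^sup>2) = 1}"
  proof
    show "topspace (nsphere n) \<subseteq> PiE UNIV I \<inter> {x. (\<Sum>i\<le>n. (x i)\<^sup>2) = 1}"
    proof
      fix x assume x: "x \<in> topspace (nsphere n)"
      have "x i \<in> I i" for i
        using abs_le_1_nsphere[OF x, of i] x by (auto simp: I_def topspace_nsphere abs_le_iff)
      with x show "x \<in> PiE UNIV I \<inter> {x. (\<Sum>i\<le>n. (x i)\<^sup>2) = 1}"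
        by (auto simp: topspace_nsphere)
    qed
    show "PiE UNIV I \<inter> {x. (\<Sum>i\<le>n. (x i)\<^sup>2) = 1} \<subseteq> topspace (nsphere n)"
    proof
      fix x assume "x \<in> PiE UNIV I \<inter> {x. (\<Sum>i\<le>n. (x i)\<^sup>2) = 1}"
      hence x: "\<And>i. x i \<in> I i" "(\<Sum>i\<le>n. (x i)\<^sup>2) = 1" by auto
      have "x i = 0" if "i > n" for i using x(1)[of i] that by (simp add: I_def)
      with x show "x \<in> topspace (nsphere n)" by (simp add: topspace_nsphere)
    qed
  qed
  ultimately show ?thesis using I by (metis compact_Int_closed)
qed

lemma sum_squares_pos:
  fixes x :: "nat \<Rightarrow> real"
  assumes "\<exists>i\<le>n. x i \<noteq> 0"
  shows "(\<Sum>j\<le>n. (x j)\<^sup>2) > 0"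
proof -
  obtain i where "i \<le> n" "x i \<noteq> 0" using assms by auto
  thus ?thesis by (intro sum_pos2[of "{..n}" i]) auto
qed

lemma sphere_normalize_id:
  "x \<in> topspace (nsphere n) \<Longrightarrow> sphere_normalize n x = x"
  by (auto simp: sphere_normalize_def topspace_nsphere fun_eq_iff)

lemma sphere_normalize_uminus: "sphere_normalize n (- x) = - sphere_normalize n x"
  by (auto simp: sphere_normalize_def fun_eq_iff)

lemma sphere_normalize_in_nsphere:
  assumes "\<exists>i\<le>n. x i \<noteq> 0"
  shows "sphere_normalize n x \<in> topspace (nsphere n)"
proof -
  have "(\<Sum>i\<le>n. (x i / sqrt (\<Sum>j\<le>n. (x j)\<^sup>2))\<^sup>2) = (\<Sum>i\<le>n. (x i)\<^sup>2) / (\<Sum>j\<le>n. (x j)\<^sup>2)"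
    using sum_squares_pos[OF assms] by (simp add: power_divide flip: sum_divide_distrib)
  with sum_squares_pos[OF assms] show ?thesis
    by (simp add: topspace_nsphere sphere_normalize_def flip: sum_divide_distrib)
qed

lemma continuous_map_sphere_normalize:
  assumes "\<And>i. i \<le> n \<Longrightarrow> continuous_map X euclideanreal (\<lambda>x. g x i)"
    and "\<And>x. x \<in> topspace X \<Longrightarrow> \<exists>i\<le>n. g x i \<noteq> 0"
  shows "continuous_map X (nsphere n) (\<lambda>x. sphere_normalize n (g x))"
proof -
  have "continuous_map X euclideanreal (\<lambda>x. sphere_normalize n (g x) i)" for i
  proof (cases "i \<le> n")
    case True
    have "(\<Sum>j\<le>n. (g x j)\<^sup>2) \<noteq> 0" if "x \<in> topspace X" for x
      using sum_squares_pos assms(2)[OF that] by (metis less_irrefl)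
    with True show ?thesis unfolding sphere_normalize_def
      by (simp, intro continuous_intros) (auto simp: assms)
  qed (simp add: sphere_normalize_def)
  moreover have "sphere_normalize n (g x) \<in> topspace (nsphere n)" if "x \<in> topspace X" for x
    by (rule sphere_normalize_in_nsphere[OF assms(2)[OF that]])
  ultimately show ?thesis
    unfolding nsphere continuous_map_in_subtopology
    by (auto simp: continuous_map_componentwise_UNIV topspace_nsphere)
qed

text \<open>The homotopy is the normalized straight segment from \<open>g\<close> to
  \<open>h\<close>; by \<open>nz\<close> no segment meets the origin.\<close>

lemma homotopic_sphere_normalize:
  assumes "\<And>i. i \<le> n \<Longrightarrow> continuous_map (nsphere n) euclideanreal (\<lambda>x. g x i)"
    and "\<And>i. i \<le> n \<Longrightarrow> continuous_map (nsphere n) euclideanreal (\<lambda>x. h x i)"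
    and nz: "\<And>x t. x \<in> topspace (nsphere n) \<Longrightarrow> 0 \<le> t \<Longrightarrow> t \<le> 1 \<Longrightarrow>
        \<exists>i\<le>n. (1 - t) * g x i + t * h x i \<noteq> 0"
  shows "homotopic_with (\<lambda>x. True) (nsphere n) (nsphere n)
    (\<lambda>x. sphere_normalize n (g x)) (\<lambda>x. sphere_normalize n (h x))"
proof -
  let ?H = "\<lambda>z i. (1 - fst z) * g (snd z) i + fst z * h (snd z) i"
  have snd: "continuous_map (prod_topology (top_of_set {0..1::real}) (nsphere n)) euclideanreal (\<lambda>z. k (snd z))"
    if "continuous_map (nsphere n) euclideanreal k" for k
    using continuous_map_compose[OF continuous_map_snd that] by (simp add: o_def)
  have fst: "continuous_map (prod_topology (top_of_set {0..1::real}) (nsphere n)) euclideanreal fst"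
    using continuous_map_fst continuous_map_in_subtopology by blast
  have "continuous_map (prod_topology (top_of_set {0..1::real}) (nsphere n)) (nsphere n)
     (\<lambda>z. sphere_normalize n (?H z))"
  proof (rule continuous_map_sphere_normalize)
    show "continuous_map (prod_topology (top_of_set {0..1::real}) (nsphere n)) euclideanreal (\<lambda>z. ?H z i)"
      if "i \<le> n" for i
      using that by (intro continuous_intros fst snd assms)
    show "\<exists>i\<le>n. ?H z i \<noteq> 0" if "z \<in> topspace (prod_topology (top_of_set {0..1::real}) (nsphere n))" for z
      using nz[of "snd z" "fst z"] that by (cases z) simp
  qed
  thus ?thesis
    unfolding homotopic_with_def by (intro exI conjI) (assumption, simp_all)
qed

subsection \<open>Odd maps of spheres have odd degree\<close>

text \<open>Stone-Weierstrass for the ring \<open>R\<close> of functions that are Lipschitz for the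
  l1 distance \<open>D\<close>. Compactness bounds the factors of a product, which keeps products
  Lipschitz; the coordinates up to \<open>n\<close> separate points.\<close>

lemma lipschitz_approximation:
  fixes f :: "(nat \<Rightarrow> real) \<Rightarrow> real"
  assumes f: "continuous_on (topspace (nsphere n)) f" and "e > 0"
  obtains g L where "continuous_on (topspace (nsphere n)) g"
    and "\<And>x. x \<in> topspace (nsphere n) \<Longrightarrow> \<bar>f x - g x\<bar> < e"
    and "\<And>x y. \<lbrakk>x \<in> topspace (nsphere n); y \<in> topspace (nsphere n)\<rbrakk>
      \<Longrightarrow> \<bar>g x - g y\<bar> \<le> L * (\<Sum>i\<le>n. \<bar>x i - y i\<bar>)"
proof -
  define S where "S = topspace (nsphere n)"
  define D where "D = (\<lambda>x y :: nat \<Rightarrow> real. \<Sum>i\<le>n. \<bar>x i - y i\<bar>)"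
  define R where "R = {g. continuous_on S g \<and> (\<exists>L. \<forall>x\<in>S. \<forall>y\<in>S. \<bar>g x - g y\<bar> \<le> L * D x y)}"
  interpret function_ring_on R S
  proof
    show "compact S" by (simp add: S_def compact_nsphere)
    show "continuous_on S g" if "g \<in> R" for g using that by (simp add: R_def)
    show "(\<lambda>x. g x + h x) \<in> R" if gh: "g \<in> R" "h \<in> R" for g h
    proof -
      obtain L M where L: "\<forall>x\<in>S. \<forall>y\<in>S. \<bar>g x - g y\<bar> \<le> L * D x y"
        and M: "\<forall>x\<in>S. \<forall>y\<in>S. \<bar>h x - h y\<bar> \<le> M * D x y"
        using gh by (auto simp: R_def)
      have "\<bar>(g x + h x) - (g y + h y)\<bar> \<le> (L + M) * D x y" if "x \<in> S" "y \<in> S" for x y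
      proof -
        have "\<bar>g x - g y\<bar> \<le> L * D x y" "\<bar>h x - h y\<bar> \<le> M * D x y"
          using L M that by auto
        thus ?thesis unfolding distrib_right by linarith
      qed
      with gh show ?thesis by (auto simp: R_def intro!: continuous_on_add)
    qed
    show "(\<lambda>x. g x * h x) \<in> R" if gh: "g \<in> R" "h \<in> R" for g h
    proof -
      obtain L M where L: "\<forall>x\<in>S. \<forall>y\<in>S. \<bar>g x - g y\<bar> \<le> L * D x y"
        and M: "\<forall>x\<in>S. \<forall>y\<in>S. \<bar>h x - h y\<bar> \<le> M * D x y"
        and cont: "continuous_on S g" "continuous_on S h"
        using gh by (auto simp: R_def)
      have "bounded (g ` S)" "bounded (h ` S)"
        using cont compact_nsphere by (auto simp: S_def compact_continuous_image compact_imp_bounded)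
      then obtain A B where A: "\<forall>x\<in>S. \<bar>g x\<bar> \<le> A" and B: "\<forall>x\<in>S. \<bar>h x\<bar> \<le> B"
        unfolding bounded_iff by auto
      have "\<bar>g x * h x - g y * h y\<bar> \<le> (A * M + B * L) * D x y" if xy: "x \<in> S" "y \<in> S" for x y
      proof -
        have "g x * h x - g y * h y = g x * (h x - h y) + h y * (g x - g y)"
          by (simp add: algebra_simps)
        hence "\<bar>g x * h x - g y * h y\<bar> \<le> \<bar>g x\<bar> * \<bar>h x - h y\<bar> + \<bar>h y\<bar> * \<bar>g x - g y\<bar>"
          using abs_triangle_ineq[of "g x * (h x - h y)" "h y * (g x - g y)"]
          by (simp add: abs_mult)
        also have "\<dots> \<le> A * (M * D x y) + B * (L * D x y)"
          using A B L M xy by (intro add_mono mult_mono) (auto intro: order_trans[OF abs_ge_zero])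
        finally show ?thesis by (simp add: algebra_simps)
      qed
      with gh show ?thesis by (auto simp: R_def intro!: continuous_on_mult)
    qed
    show "(\<lambda>_. c) \<in> R" for c
      by (auto simp: R_def intro!: exI[of _ 0])
    show "\<exists>f\<in>R. f x \<noteq> f y" if xy: "x \<in> S" "y \<in> S" "x \<noteq> y" for x y
    proof -
      obtain i where i: "x i \<noteq> y i" using xy by (auto simp: fun_eq_iff)
      have "i \<le> n"
      proof (rule ccontr)
        assume "\<not> i \<le> n"
        with xy have "x i = 0" "y i = 0" by (auto simp: S_def topspace_nsphere)
        with i show False by simp
      qed
      hence "\<bar>u i - v i\<bar> \<le> 1 * D u v" for u v
        unfolding D_def by (simp add: member_le_sum[of i "{..n}" "\<lambda>i. \<bar>u i - v i\<bar>"])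
      hence "(\<lambda>x. x i) \<in> R"
        unfolding R_def by (auto intro!: continuous_on_subset[OF continuous_on_product_coordinates] exI[of _ 1])
      with i show ?thesis by (intro bexI[of _ "\<lambda>x. x i"])
    qed
  qed
  obtain g where "g \<in> R" "\<forall>x\<in>S. \<bar>f x - g x\<bar> < e"
    using Stone_Weierstrass_basic[of f e] assms by (auto simp: S_def)
  thus ?thesis using that unfolding R_def S_def D_def by blast
qed

section \<open>Small cells of the sphere, and lines missed by Lipschitz images\<close>

lemma nsphere_max_coordinate:
  assumes "x \<in> topspace (nsphere n)"
  obtains j where "j \<le> n" "x j \<noteq> 0" "\<And>i. i \<le> n \<Longrightarrow> \<bar>x i\<bar> \<le> \<bar>x j\<bar>"
proof -
  let ?M = "Max ((\<lambda>i. \<bar>x i\<bar>) ` {..n})"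
  have "?M \<in> (\<lambda>i. \<bar>x i\<bar>) ` {..n}" by (intro Max_in) auto
  then obtain j where j: "j \<le> n" "?M = \<bar>x j\<bar>" by (metis (no_types, lifting) atMost_iff imageE)
  have le: "\<bar>x i\<bar> \<le> \<bar>x j\<bar>" if "i \<le> n" for i
    using that by (simp flip: j(2))
  have "x j \<noteq> 0"
  proof
    assume "x j = 0"
    with le have "(\<Sum>i\<le>n. (x i)\<^sup>2) = 0" by simp
    with assms show False by (simp add: topspace_nsphere)
  qed
  with j le that show thesis by blast
qed

text \<open>The largest coordinate is a Lipschitz function of the others, so only those are rounded;
  this is why the number of cells grows like \<open>m ^ n\<close> and not like \<open>m ^ (n + 1)\<close>.\<close>

lemma nsphere_cells:
  assumes "m > 0"
  shows "\<exists>C (cell :: (nat \<Rightarrow> real) \<Rightarrow> nat \<times> bool \<times> (nat \<Rightarrow> int)).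
    finite C \<and> card C \<le> (2 * Suc n * 3 ^ n) * m ^ n \<and> cell ` topspace (nsphere n) \<subseteq> C \<and>
    (\<forall>x\<in>topspace (nsphere n). \<forall>y\<in>topspace (nsphere n).
      cell x = cell y \<longrightarrow> (\<Sum>i\<le>n. \<bar>x i - y i\<bar>) \<le> real (2 * n) / real m)"
proof -
  define jm where "jm = (\<lambda>x::nat \<Rightarrow> real. SOME j. j \<le> n \<and> x j \<noteq> 0 \<and> (\<forall>i\<le>n. \<bar>x i\<bar> \<le> \<bar>x j\<bar>))"
  have jm: "jm x \<le> n \<and> x (jm x) \<noteq> 0 \<and> (\<forall>i\<le>n. \<bar>x i\<bar> \<le> \<bar>x (jm x)\<bar>)"
    if x: "x \<in> topspace (nsphere n)" for x
    unfolding jm_def by (rule someI_ex) (metis nsphere_max_coordinate[OF x])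
  define cell where "cell = (\<lambda>x::nat \<Rightarrow> real.
    (jm x, x (jm x) > 0, restrict (\<lambda>i. \<lfloor>real m * x i\<rfloor>) ({..n} - {jm x})))"
  define C where "C = (SIGMA j:{..n}. (UNIV :: bool set) \<times> (({..n} - {j}) \<rightarrow>\<^sub>E {- int m..int m}))"
  have "finite C" unfolding C_def by (intro finite_SigmaI finite_PiE) auto
  moreover have "card C \<le> (2 * Suc n * 3 ^ n) * m ^ n"
  proof -
    \<comment> \<open>For each position of the largest coordinate there are two signs, and
      \<open>2 * m + 1\<close> possible floors for each of the other \<open>n\<close>
      coordinates.\<close>
    have "card C = (\<Sum>j\<le>n. 2 * (2 * m + 1) ^ n)"
      unfolding C_def
      by (subst card_SigmaI) (auto simp: card_cartesian_product card_PiE finite_PiE nat_add_distrib nat_mult_distrib intro!: sum.cong)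
    also have "\<dots> \<le> (\<Sum>j\<le>n. 2 * (3 * m) ^ n)"
      using assms by (intro sum_mono mult_left_mono power_mono) auto
    finally show ?thesis by (simp add: power_mult_distrib algebra_simps)
  qed
  moreover have "cell x \<in> C" if x: "x \<in> topspace (nsphere n)" for x
  proof -
    have "\<lfloor>real m * x i\<rfloor> \<in> {- int m..int m}" for i
    proof -
      have "\<bar>real m * x i\<bar> \<le> real m * 1"
        unfolding abs_mult using abs_le_1_nsphere[OF x, of i] by (intro mult_mono) auto
      hence "- real m \<le> real m * x i" "real m * x i \<le> real m" by (auto simp: abs_le_iff)
      thus ?thesis by (simp add: le_floor_iff) linarith
    qed
    with jm[OF x] show ?thesis by (auto simp: cell_def C_def)
  qed
  moreover have "(\<Sum>i\<le>n. \<bar>x i - y i\<bar>) \<le> real (2 * n) / real m"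
    if x: "x \<in> topspace (nsphere n)" and y: "y \<in> topspace (nsphere n)" and eq: "cell x = cell y"
    for x y
  proof -
    define j where "j = jm x"
    have jx: "j \<le> n" "x j \<noteq> 0" "\<And>i. i \<le> n \<Longrightarrow> \<bar>x i\<bar> \<le> \<bar>x j\<bar>"
      using jm[OF x] by (auto simp: j_def)
    have yj: "jm y = j" using eq by (simp add: cell_def j_def)
    have jy: "y j \<noteq> 0" "\<And>i. i \<le> n \<Longrightarrow> \<bar>y i\<bar> \<le> \<bar>y j\<bar>"
      using jm[OF y] by (auto simp: yj)
    have sgn: "x j > 0 \<longleftrightarrow> y j > 0" using eq by (simp add: cell_def yj flip: j_def)
    have close: "\<bar>x i - y i\<bar> \<le> 1 / m" if i: "i \<in> {..n} - {j}" for i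
    proof -
      have "restrict (\<lambda>i. \<lfloor>real m * x i\<rfloor>) ({..n} - {j}) i = restrict (\<lambda>i. \<lfloor>real m * y i\<rfloor>) ({..n} - {j}) i"
        using eq by (simp add: cell_def yj flip: j_def)
      hence "\<lfloor>real m * x i\<rfloor> = \<lfloor>real m * y i\<rfloor>" using i by simp
      hence "\<bar>real m * x i - real m * y i\<bar> \<le> 1" by linarith
      hence "real m * \<bar>x i - y i\<bar> \<le> 1" by (simp flip: right_diff_distrib add: abs_mult)
      thus ?thesis using assms by (simp add: field_simps)
    qed
    have split: "(\<Sum>i\<le>n. f i) = f j + (\<Sum>i\<in>{..n} - {j}. f i)" for f :: "nat \<Rightarrow> real"
      using jx(1) by (simp add: sum.remove)
    \<comment> \<open>Equal norms express the difference of squares in coordinate \<open>j\<close>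
      through those in the others. As \<open>x j\<close> and \<open>y j\<close> have the same sign,
      the absolute value of \<open>x j + y j\<close> dominates that of every
      \<open>x i + y i\<close> and can be cancelled.\<close>
    have abs: "\<bar>x j + y j\<bar> = \<bar>x j\<bar> + \<bar>y j\<bar>" using sgn jx(2) jy(1) by auto
    have "(\<Sum>i\<le>n. (x i)\<^sup>2) = (\<Sum>i\<le>n. (y i)\<^sup>2)"
      using x y by (simp add: topspace_nsphere)
    hence "(x j - y j) * (x j + y j) = (\<Sum>i\<in>{..n} - {j}. (y i - x i) * (y i + x i))"
      unfolding split by (simp add: algebra_simps power2_eq_square sum_subtractf sum.distrib)
    hence "\<bar>x j - y j\<bar> * \<bar>x j + y j\<bar> \<le> (\<Sum>i\<in>{..n} - {j}. \<bar>y i - x i\<bar> * \<bar>y i + x i\<bar>)"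
      by (simp flip: abs_mult)
    also have "\<dots> \<le> (\<Sum>i\<in>{..n} - {j}. 1 / m * \<bar>x j + y j\<bar>)"
    proof (intro sum_mono mult_mono)
      fix i assume i: "i \<in> {..n} - {j}"
      show "\<bar>y i - x i\<bar> \<le> 1 / m" using close[OF i] by (simp add: abs_minus_commute)
      show "\<bar>y i + x i\<bar> \<le> \<bar>x j + y j\<bar>"
        using jx(3)[of i] jy(2)[of i] i abs abs_triangle_ineq[of "y i" "x i"] by auto
    qed auto
    also have "\<dots> = (real n / m) * \<bar>x j + y j\<bar>" using jx(1) by (simp add: card_Diff_singleton)
    finally have "\<bar>x j - y j\<bar> \<le> real n / m"
      by (rule mult_right_le_imp_le) (use jx(2) abs in linarith)
    moreover have "(\<Sum>i\<in>{..n} - {j}. \<bar>x i - y i\<bar>) \<le> (\<Sum>i\<in>{..n} - {j}. 1 / m)"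
      by (intro sum_mono close)
    moreover have "\<dots> = real n / m" using jx(1) by (simp add: card_Diff_singleton)
    ultimately have "(\<Sum>i\<le>n. \<bar>x i - y i\<bar>) \<le> real n / m + real n / m"
      unfolding split by linarith
    thus ?thesis by (simp add: add_divide_distrib)
  qed
  ultimately show ?thesis by (intro exI[of _ C] exI[of _ cell]) blast
qed

text \<open>Counting: about \<open>m ^ n\<close> cells of the sphere, each of which accounts for a bounded number
  of the \<open>m ^ (n + 1)\<close> candidates \<open>q = a / m\<close>.\<close>

lemma lipschitz_avoids_ratio:
  fixes h :: "(nat \<Rightarrow> real) \<Rightarrow> nat \<Rightarrow> real"
  assumes lip: "\<And>i x y. \<lbrakk>i \<le> Suc n; x \<in> topspace (nsphere n); y \<in> topspace (nsphere n)\<rbrakk>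
      \<Longrightarrow> \<bar>h x i - h y i\<bar> \<le> L * (\<Sum>i\<le>n. \<bar>x i - y i\<bar>)"
    and "c > 0" and c: "\<And>x. x \<in> topspace (nsphere n) \<Longrightarrow> \<exists>i\<le>Suc n. c \<le> \<bar>h x i\<bar>"
  shows "\<exists>q. \<forall>x\<in>topspace (nsphere n). \<exists>i\<le>n. h x i \<noteq> q i * h x (Suc n)"
proof (rule ccontr)
  assume "\<not> ?thesis"
  hence hit: "\<exists>x\<in>topspace (nsphere n). \<forall>i\<le>n. h x i = q i * h x (Suc n)" for q
    by blast
  \<comment> \<open>The Lipschitz bound at two antipodal points, whose distance is positive,
    excludes a negative \<open>L\<close>.\<close>
  have "L \<ge> 0"
  proof (rule ccontr)
    define u where "u = (\<lambda>i::nat. if i = 0 then 1 else 0 :: real)"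
    have u: "u \<in> topspace (nsphere n)" unfolding u_def by (rule in_topspace_nsphere)
    assume "\<not> L \<ge> 0"
    moreover have "(\<Sum>i\<le>n. \<bar>u i - (- u) i\<bar>) > 0"
      by (intro sum_pos2[of _ 0]) (auto simp: u_def)
    ultimately have "L * (\<Sum>i\<le>n. \<bar>u i - (- u) i\<bar>) < 0"
      by (simp add: mult_neg_pos)
    with lip[of 0 u "- u"] u uminus_in_nsphere[OF u] show False by auto
  qed
  \<comment> \<open>\<open>B\<close> will bound the difference of the numerators of two candidates
    whose points share a cell. \<open>K * m ^ n\<close> will bound the number of pairs of a cell and
    a residue pattern, so with \<open>m = Suc K\<close> the \<open>m ^ Suc n\<close> candidates are
    too many.\<close>
  define B where "B = nat \<lceil>4 * L * n / c\<rceil>"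
  have B: "4 * L * n / c \<le> real B" unfolding B_def by linarith
  define K where "K = (2 * Suc n * 3 ^ n) * Suc B ^ Suc n"
  define m where "m = Suc K"
  have m: "m > 0" by (simp add: m_def)
  obtain C and cell :: "(nat \<Rightarrow> real) \<Rightarrow> nat \<times> bool \<times> (nat \<Rightarrow> int)" where
    C: "finite C" "card C \<le> (2 * Suc n * 3 ^ n) * m ^ n" "cell ` topspace (nsphere n) \<subseteq> C"
    and cell: "\<forall>x\<in>topspace (nsphere n). \<forall>y\<in>topspace (nsphere n).
      cell x = cell y \<longrightarrow> (\<Sum>i\<le>n. \<bar>x i - y i\<bar>) \<le> real (2 * n) / real m"
    using nsphere_cells[OF m, of n] by blast
  define A where "A = ({..n} \<rightarrow>\<^sub>E {..<m})"
  have "\<forall>a. \<exists>x. x \<in> topspace (nsphere n) \<and>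
    (\<forall>i\<le>n. h x i = (real (a i) / real m) * h x (Suc n))"
  proof
    fix a :: "nat \<Rightarrow> nat"
    from hit[of "\<lambda>i. real (a i) / real m"]
    show "\<exists>x. x \<in> topspace (nsphere n) \<and> (\<forall>i\<le>n. h x i = (real (a i) / real m) * h x (Suc n))"
      by (simp only: Bex_def)
  qed
  from choice[OF this] obtain X where X: "\<And>a. X a \<in> topspace (nsphere n) \<and>
    (\<forall>i\<le>n. h (X a) i = (real (a i) / real m) * h (X a) (Suc n))"
    by blast
  have near: "\<bar>real (a i) - real (b i)\<bar> \<le> real B"
    if a: "a \<in> A" and b: "b \<in> A" and eq: "cell (X a) = cell (X b)" and i: "i \<le> n" for a b i
  proof -
    let ?x = "X a" and ?y = "X b"
    have le1: "real (e i) / m \<le> 1" if "e \<in> A" "i \<le> n" for e i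
    proof -
      have "e i < m" using that by (auto simp: A_def)
      thus ?thesis by simp
    qed
    have d: "\<bar>h ?x k - h ?y k\<bar> \<le> L * (real (2 * n) / m)" if "k \<le> Suc n" for k
    proof -
      have "(\<Sum>i\<le>n. \<bar>?x i - ?y i\<bar>) \<le> real (2 * n) / m" using cell X eq by blast
      from mult_left_mono[OF this \<open>L \<ge> 0\<close>] lip[OF that, of ?x ?y] X show ?thesis
        by (meson order_trans)
    qed
    \<comment> \<open>The ratios \<open>a i / m\<close> are at most 1, so at a point hit by the
      candidate the last component is the largest in absolute value.\<close>
    have hc: "c \<le> \<bar>h ?x (Suc n)\<bar>"
    proof -
      obtain k where k: "k \<le> Suc n" "c \<le> \<bar>h ?x k\<bar>" using c X by blast
      show ?thesis
      proof (cases "k = Suc n")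
        case False
        with k have "k \<le> n" by simp
        hence "\<bar>h ?x k\<bar> = (real (a k) / m) * \<bar>h ?x (Suc n)\<bar>"
          using X[of a] by (simp add: abs_mult)
        also have "\<dots> \<le> 1 * \<bar>h ?x (Suc n)\<bar>"
          using le1[OF a \<open>k \<le> n\<close>] by (intro mult_right_mono) auto
        finally show ?thesis using k by simp
      qed (use k in simp)
    qed
    \<comment> \<open>Each point satisfies the equation of its own candidate. Subtracting isolates
      the difference of the ratios, multiplied by a component that is at least \<open>c\<close> in
      absolute value.\<close>
    have "(real (a i) / m - real (b i) / m) * h ?x (Suc n)
        = (h ?x i - h ?y i) + (real (b i) / m) * (h ?y (Suc n) - h ?x (Suc n))"
      using X[of a] X[of b] i by (simp add: algebra_simps)
    hence "\<bar>real (a i) / m - real (b i) / m\<bar> * \<bar>h ?x (Suc n)\<bar>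
        = \<bar>(h ?x i - h ?y i) + (real (b i) / m) * (h ?y (Suc n) - h ?x (Suc n))\<bar>"
      by (simp only: abs_mult[symmetric])
    also have "\<dots> \<le> \<bar>h ?x i - h ?y i\<bar> + (real (b i) / m) * \<bar>h ?y (Suc n) - h ?x (Suc n)\<bar>"
      by (rule order_trans[OF abs_triangle_ineq]) (simp add: abs_mult)
    also have "\<dots> \<le> L * (real (2 * n) / m) + 1 * (L * (real (2 * n) / m))"
      using d[of i] d[of "Suc n"] le1[OF b i] i
      by (intro add_mono mult_mono) (auto simp: abs_minus_commute)
    finally have "\<bar>real (a i) / m - real (b i) / m\<bar> * \<bar>h ?x (Suc n)\<bar> \<le> 4 * L * n / m"
      by simp
    with mult_left_mono[OF hc abs_ge_zero, of "real (a i) / m - real (b i) / m"]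
    have "\<bar>real (a i) / m - real (b i) / m\<bar> * c \<le> 4 * L * n / m"
      by (rule order_trans)
    moreover have "\<bar>real (a i) / m - real (b i) / m\<bar> = \<bar>real (a i) - real (b i)\<bar> / m"
      by (simp flip: diff_divide_distrib)
    ultimately have "\<bar>real (a i) - real (b i)\<bar> * c \<le> 4 * L * n"
      using m by (simp add: field_simps)
    hence "\<bar>real (a i) - real (b i)\<bar> \<le> 4 * L * n / c"
      using \<open>c > 0\<close> by (simp add: field_simps)
    with B show ?thesis by linarith
  qed
  \<comment> \<open>Within a cell numerators differ by at most \<open>B\<close>, so their residues
    modulo \<open>Suc B\<close> tell them apart.\<close>
  define \<phi> where "\<phi> = (\<lambda>a. (cell (X a), restrict (\<lambda>i. a i mod Suc B) {..n}))"
  have "inj_on \<phi> A"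
  proof (rule inj_onI)
    fix a b assume ab: "a \<in> A" "b \<in> A" "\<phi> a = \<phi> b"
    have "a i = b i" if i: "i \<le> n" for i
    proof -
      have "restrict (\<lambda>i. a i mod Suc B) {..n} i = restrict (\<lambda>i. b i mod Suc B) {..n} i"
        using ab(3) by (simp add: \<phi>_def)
      hence mod: "a i mod Suc B = b i mod Suc B" using i by simp
      have "\<bar>real (a i) - real (b i)\<bar> \<le> real B"
        using near[OF ab(1,2) _ i] ab(3) by (simp add: \<phi>_def)
      hence lt: "\<bar>int (a i) - int (b i)\<bar> < int (Suc B)" by linarith
      have "int (Suc B) dvd int (a i) - int (b i)"
        using mod by (metis mod_eq_dvd_iff zmod_int)
      hence "int (a i) - int (b i) = 0"
        using dvd_imp_le_int[of "int (a i) - int (b i)" "int (Suc B)"] lt by linarith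
      thus ?thesis by simp
    qed
    with ab(1,2) show "a = b" by (auto simp: A_def intro: PiE_ext)
  qed
  moreover have "\<phi> ` A \<subseteq> C \<times> ({..n} \<rightarrow>\<^sub>E {..<Suc B})"
  proof (rule image_subsetI)
    fix a
    have "cell (X a) \<in> C" using C(3) X by blast
    thus "\<phi> a \<in> C \<times> ({..n} \<rightarrow>\<^sub>E {..<Suc B})" by (simp add: \<phi>_def)
  qed
  moreover have "finite (C \<times> ({..n} \<rightarrow>\<^sub>E {..<Suc B}))"
    using C(1) by (intro finite_cartesian_product finite_PiE) auto
  ultimately have "card A \<le> card (C \<times> ({..n} \<rightarrow>\<^sub>E {..<Suc B}))"
    by (rule card_inj_on_le)
  also have "\<dots> = card C * Suc B ^ Suc n"
    by (simp add: card_cartesian_product card_PiE)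
  also have "\<dots> \<le> ((2 * Suc n * 3 ^ n) * m ^ n) * Suc B ^ Suc n"
    using C(2) by (rule mult_right_mono) simp
  also have "\<dots> = K * m ^ n" by (simp add: K_def)
  also have "\<dots> < m * m ^ n" using m by (simp add: m_def)
  also have "\<dots> = card A" by (simp add: A_def card_PiE)
  finally show False by simp
qed

section \<open>Parity of the degree, and the Borsuk-Ulam theorem\<close>

lemma continuous_map_nsphere_component:
  assumes "continuous_map X (nsphere n) f"
  shows "continuous_map X euclideanreal (\<lambda>x. f x i)"
  using continuous_map_compose[OF assms continuous_map_nsphere_projection] by (simp add: o_def)

lemma continuous_map_nsphere_uminus: "continuous_map (nsphere n) (nsphere n) uminus"
proof -
  have "continuous_map (nsphere n) (nsphere n) (\<lambda>x. sphere_normalize n (- x))"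
  proof (rule continuous_map_sphere_normalize)
    show "continuous_map (nsphere n) euclideanreal (\<lambda>x. (- x) i)" for i
      by (simp add: continuous_map_nsphere_projection continuous_map_minus)
    show "\<exists>i\<le>n. (- x) i \<noteq> 0" if "x \<in> topspace (nsphere n)" for x
      using nsphere_max_coordinate[OF that] by (metis neg_equal_0_iff_equal uminus_apply)
  qed
  thus ?thesis
    by (rule continuous_map_eq) (simp add: sphere_normalize_id uminus_in_nsphere)
qed

lemma nsphere_mono: "x \<in> topspace (nsphere n) \<Longrightarrow> x \<in> topspace (nsphere (Suc n))"
  by (simp add: topspace_nsphere)

lemma continuous_map_nsphere_restrict:
  assumes "continuous_map (nsphere (Suc n)) Y f"
  shows "continuous_map (nsphere n) Y f"
  using continuous_map_from_subtopology[OF assms, of "{x. x (Suc n) = 0}"]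
  by (simp add: subtopology_nsphere_equator)

text \<open>On the two points of the 0-sphere an odd map is the identity or the antipodal map; the
  latter agrees there with the reflection in coordinate 0, of degree -1.\<close>

lemma odd_degree_nsphere_0:
  assumes f: "continuous_map (nsphere 0) (nsphere 0) f"
    and odd: "\<And>x. x \<in> topspace (nsphere 0) \<Longrightarrow> f (- x) = - f x"
  shows "odd (Brouwer_degree2 0 f)"
proof -
  define u where "u = (\<lambda>i::nat. if i = 0 then 1 else 0 :: real)"
  have S: "topspace (nsphere 0) = {u, - u}"
  proof -
    have "x = u \<or> x = - u" if "x \<in> topspace (nsphere 0)" for x
    proof -
      have x: "x 0 = 1 \<or> x 0 = - 1" "\<And>i. i > 0 \<Longrightarrow> x i = 0"
        using that by (auto simp: topspace_nsphere power2_eq_1_iff)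
      thus ?thesis by (auto simp: u_def fun_eq_iff)
    qed
    moreover have "u \<in> topspace (nsphere 0)" unfolding u_def by (rule in_topspace_nsphere)
    ultimately show ?thesis using uminus_in_nsphere by blast
  qed
  have "f u \<in> topspace (nsphere 0)" using continuous_map_image_subset_topspace[OF f] S by auto
  then consider "f u = u" | "f u = - u" using S by auto
  thus ?thesis
  proof cases
    case 1
    hence "Brouwer_degree2 0 f = Brouwer_degree2 0 id"
      by (intro Brouwer_degree2_eq) (use S odd[of u] in auto)
    thus ?thesis by simp
  next
    case 2
    moreover have "(\<lambda>i. if i = 0 then - x i else x i) = - x" if "x \<in> topspace (nsphere 0)" for x
      using that by (auto simp: topspace_nsphere fun_eq_iff)
    ultimately have "Brouwer_degree2 0 f = Brouwer_degree2 0 (\<lambda>x i. if i = 0 then - x i else x i)"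
      using odd[of u] by (intro Brouwer_degree2_eq) (auto simp: S)
    thus ?thesis by (simp add: Brouwer_degree2_reflection)
  qed
qed

text \<open>Induction on the dimension. \<open>Borsuk_odd_mapping_degree_step\<close> passes the
  parity from the equator to the sphere for odd maps that preserve the equator; the homotopies from
  \<open>f\<close> to \<open>h\<close> and from \<open>h\<close> to \<open>k\<close> lead to such a
  map \<open>s\<close> of the same degree.\<close>

theorem odd_Brouwer_degree2:
  assumes "continuous_map (nsphere n) (nsphere n) f"
    and "\<And>x. x \<in> topspace (nsphere n) \<Longrightarrow> f (- x) = - f x"
  shows "odd (Brouwer_degree2 n f)"
  using assms
proof (induction n arbitrary: f)
  case 0
  thus ?case by (rule odd_degree_nsphere_0)
next
  case (Suc n)
  let ?S = "nsphere (Suc n)"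
  note f = Suc.prems(1) and oddf = Suc.prems(2)
  \<comment> \<open>A unit vector has a coordinate of absolute value at least
    \<open>2 * e = 1 / (n + 2)\<close>: its \<open>n + 2\<close> squares add up to 1, and each is at
    most the absolute value of the coordinate. An error below \<open>e\<close> cannot cancel this
    coordinate.\<close>
  define e where "e = 1 / (2 * (real n + 2))"
  have e: "e > 0" by (simp add: e_def)
  define P where "P = (\<lambda>i g L. continuous_on (topspace ?S) g \<and>
    (\<forall>x\<in>topspace ?S. \<bar>f x i - g x\<bar> < e) \<and>
    (\<forall>x\<in>topspace ?S. \<forall>y\<in>topspace ?S. \<bar>g x - g y\<bar> \<le> L * (\<Sum>i\<le>Suc n. \<bar>x i - y i\<bar>)))"
  have "\<exists>g L. P i g L" for i
  proof -
    have "continuous_on (topspace ?S) (\<lambda>x. f x i)"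
      using continuous_map_nsphere_component[OF f, of i] by (simp only: continuous_map_nsphere_iff)
    thus ?thesis
    proof (rule lipschitz_approximation[OF _ e])
      fix g L
      assume "continuous_on (topspace ?S) g"
        and "\<And>x. x \<in> topspace ?S \<Longrightarrow> \<bar>f x i - g x\<bar> < e"
        and "\<And>x y. \<lbrakk>x \<in> topspace ?S; y \<in> topspace ?S\<rbrakk>
          \<Longrightarrow> \<bar>g x - g y\<bar> \<le> L * (\<Sum>i\<le>Suc n. \<bar>x i - y i\<bar>)"
      hence "P i g L" unfolding P_def by blast
      thus ?thesis by blast
    qed
  qed
  then obtain g L where "\<And>i. P i (g i) (L i)" by metis
  hence g: "\<And>i. continuous_on (topspace ?S) (g i)"
      "\<And>i x. x \<in> topspace ?S \<Longrightarrow> \<bar>f x i - g i x\<bar> < e"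
      "\<And>i x y. x \<in> topspace ?S \<Longrightarrow> y \<in> topspace ?S \<Longrightarrow>
        \<bar>g i x - g i y\<bar> \<le> L i * (\<Sum>i\<le>Suc n. \<bar>x i - y i\<bar>)"
    unfolding P_def by blast+
  \<comment> \<open>The odd part of the approximation. Since \<open>f\<close> is odd, averaging
    keeps the error bound \<open>e\<close> and the Lipschitz constants.\<close>
  define h where "h = (\<lambda>x i. (g i x - g i (- x)) / 2)"
  have gcm: "continuous_map ?S euclideanreal (g i)" for i
    using g(1) by (simp only: continuous_map_nsphere_iff)
  have hcm: "continuous_map ?S euclideanreal (\<lambda>x. h x i)" for i
    unfolding h_def
    by (intro continuous_intros gcm continuous_map_compose[OF continuous_map_nsphere_uminus gcm, unfolded o_def])
       auto
  have oddh: "h (- x) = - h x" for x by (simp add: h_def fun_eq_iff field_simps)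
  have fh: "\<bar>f x i - h x i\<bar> < e" if x: "x \<in> topspace ?S" for x i
    using g(2)[OF x, of i] g(2)[OF uminus_in_nsphere[OF x], of i] oddf[OF x]
    by (simp add: h_def abs_less_iff field_simps)
  have big: "\<exists>i\<le>Suc n. 2 * e \<le> \<bar>f x i\<bar>" if x: "x \<in> topspace ?S" for x
  proof (rule ccontr)
    assume "\<not> ?thesis"
    hence lt: "\<bar>f x i\<bar> < 2 * e" if "i \<le> Suc n" for i using that by force
    have fx: "f x \<in> topspace ?S" using continuous_map_image_subset_topspace[OF f] x by auto
    have "(f x i)\<^sup>2 < 2 * e" if "i \<le> Suc n" for i
    proof -
      have "(f x i)\<^sup>2 = \<bar>f x i\<bar> * \<bar>f x i\<bar>" by (simp add: power2_eq_square)
      also have "\<dots> \<le> \<bar>f x i\<bar> * 1"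
        using abs_le_1_nsphere[OF fx] by (intro mult_left_mono) auto
      finally show ?thesis using lt[OF that] by simp
    qed
    hence "(\<Sum>i\<le>Suc n. (f x i)\<^sup>2) < (\<Sum>i\<le>Suc n. 2 * e)"
      by (intro sum_strict_mono) auto
    also have "\<dots> = 1" by (simp add: e_def field_simps)
    finally show False using fx by (simp only: topspace_nsphere mem_Collect_eq)
  qed
  define M where "M = (\<Sum>i\<le>Suc n. \<bar>L i\<bar>)"
  have "\<exists>q. \<forall>x\<in>topspace (nsphere n). \<exists>i\<le>n. h x i \<noteq> q i * h x (Suc n)"
  proof (rule lipschitz_avoids_ratio[OF _ e])
    show "\<bar>h x i - h y i\<bar> \<le> M * (\<Sum>i\<le>n. \<bar>x i - y i\<bar>)"
      if i: "i \<le> Suc n" and x: "x \<in> topspace (nsphere n)" and y: "y \<in> topspace (nsphere n)" for i x y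
    proof -
      let ?d = "\<Sum>i\<le>n. \<bar>x i - y i\<bar>"
      \<comment> \<open>On the equator the last coordinate contributes nothing, and the antipodal
        map preserves distances, so both terms of \<open>h\<close> get the same bound.\<close>
      have d: "(\<Sum>i\<le>Suc n. \<bar>x i - y i\<bar>) = ?d" "(\<Sum>i\<le>Suc n. \<bar>(- x) i - (- y) i\<bar>) = ?d"
        using x y by (auto simp: topspace_nsphere abs_minus_commute intro!: sum.cong)
      have "\<bar>g i x - g i y\<bar> \<le> L i * ?d" "\<bar>g i (- x) - g i (- y)\<bar> \<le> L i * ?d"
        using g(3)[of x y i] g(3)[of "- x" "- y" i] nsphere_mono[OF x] nsphere_mono[OF y]
        unfolding d by (auto intro: uminus_in_nsphere)
      hence "\<bar>h x i - h y i\<bar> \<le> L i * ?d" unfolding h_def by (simp add: abs_le_iff field_simps)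
      also have "L i * ?d \<le> M * ?d"
      proof (rule mult_right_mono)
        have "\<bar>L i\<bar> \<le> M" unfolding M_def using i by (intro member_le_sum) auto
        thus "L i \<le> M" by simp
      qed (simp add: sum_nonneg)
      finally show ?thesis .
    qed
    show "\<exists>i\<le>Suc n. e \<le> \<bar>h x i\<bar>" if "x \<in> topspace (nsphere n)" for x
    proof -
      have x: "x \<in> topspace ?S" by (rule nsphere_mono[OF that])
      then obtain i where "i \<le> Suc n" "2 * e \<le> \<bar>f x i\<bar>" using big by blast
      moreover from fh[OF x, of i] this have "e \<le> \<bar>h x i\<bar>" by linarith
      ultimately show ?thesis by blast
    qed
  qed
  then obtain q where q: "\<And>x. x \<in> topspace (nsphere n) \<Longrightarrow> \<exists>i\<le>n. h x i \<noteq> q i * h x (Suc n)"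
    by blast
  \<comment> \<open>The shear by \<open>q\<close>; the factor in the last component makes it vanish on the equator only.\<close>
  define k where "k = (\<lambda>x i. if i \<le> n then h x i - q i * h x (Suc n) else \<bar>x (Suc n)\<bar> * h x (Suc n))"
  have kcm: "continuous_map ?S euclideanreal (\<lambda>x. k x i)" for i
    unfolding k_def
    by (cases "i \<le> n") (simp_all, (intro continuous_intros hcm continuous_map_nsphere_projection)+)
  \<comment> \<open>The absolute value in the last component of \<open>k\<close> makes the factor
    even, so that its product with the odd function \<open>h\<close> stays odd.\<close>
  have oddk: "k (- x) = - k x" for x by (auto simp: k_def oddh fun_eq_iff algebra_simps)
  have fcm: "continuous_map ?S euclideanreal (\<lambda>x. f x i)" for i
    by (rule continuous_map_nsphere_component[OF f])
  have "homotopic_with (\<lambda>x. True) ?S ?S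
    (\<lambda>x. sphere_normalize (Suc n) (f x)) (\<lambda>x. sphere_normalize (Suc n) (h x))"
  proof (rule homotopic_sphere_normalize)
    fix x t assume x: "x \<in> topspace ?S" and t: "0 \<le> t" "t \<le> (1::real)"
    obtain i where i: "i \<le> Suc n" "2 * e \<le> \<bar>f x i\<bar>" using big[OF x] by blast
    have "\<bar>t * (f x i - h x i)\<bar> < e"
    proof -
      have "\<bar>t * (f x i - h x i)\<bar> \<le> 1 * \<bar>f x i - h x i\<bar>"
        unfolding abs_mult using t by (intro mult_right_mono) auto
      with fh[OF x, of i] show ?thesis by simp
    qed
    with i e have "f x i - t * (f x i - h x i) \<noteq> 0" by auto
    moreover have "f x i - t * (f x i - h x i) = (1 - t) * f x i + t * h x i"
      by (simp add: algebra_simps)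
    ultimately show "\<exists>i\<le>Suc n. (1 - t) * f x i + t * h x i \<noteq> 0" using i by metis
  qed (intro fcm hcm)+
  hence "Brouwer_degree2 (Suc n) (\<lambda>x. sphere_normalize (Suc n) (f x))
      = Brouwer_degree2 (Suc n) (\<lambda>x. sphere_normalize (Suc n) (h x))"
    by (rule Brouwer_degree2_homotopic)
  \<comment> \<open>Where the last component of \<open>h\<close> is 0, the shear changes nothing, so
    a zero on the segment would be a zero of \<open>h\<close>. Elsewhere the last component vanishes
    only for \<open>t = 1\<close> on the equator, where the choice of \<open>q\<close> keeps some
    other component nonzero.\<close>
  moreover have knz: "\<exists>i\<le>Suc n. (1 - t) * h x i + t * k x i \<noteq> 0"
    if x: "x \<in> topspace ?S" and t: "0 \<le> t" "t \<le> (1::real)" for x t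
  proof (rule ccontr)
    assume "\<not> ?thesis"
    hence z: "(1 - t) * h x i + t * k x i = 0" if "i \<le> Suc n" for i using that by blast
    have last: "((1 - t) + t * \<bar>x (Suc n)\<bar>) * h x (Suc n) = 0"
      using z[of "Suc n"] by (simp add: k_def algebra_simps)
    show False
    proof (cases "h x (Suc n) = 0")
      case True
      have "h x i = 0" if "i \<le> n" for i
        using z[of i] that True by (simp add: k_def algebra_simps)
      with True have "h x i = 0" if "i \<le> Suc n" for i using that by (auto simp: le_Suc_eq)
      moreover obtain i where "i \<le> Suc n" "2 * e \<le> \<bar>f x i\<bar>" using big[OF x] by blast
      ultimately show False using fh[OF x, of i] e by simp
    next
      case False
      with last have "(1 - t) + t * \<bar>x (Suc n)\<bar> = 0" by simp
      moreover have "0 \<le> t * \<bar>x (Suc n)\<bar>" using t by simp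
      ultimately have "t = 1" "x (Suc n) = 0" using t by (smt (verit) mult_eq_0_iff)+
      hence "x \<in> topspace (nsphere n)" using topspace_nsphere_minus1[OF x] by simp
      then obtain i where "i \<le> n" "h x i \<noteq> q i * h x (Suc n)" using q by blast
      with z[of i] show False by (simp add: k_def \<open>t = 1\<close>)
    qed
  qed
  have "homotopic_with (\<lambda>x. True) ?S ?S
    (\<lambda>x. sphere_normalize (Suc n) (h x)) (\<lambda>x. sphere_normalize (Suc n) (k x))"
    by (rule homotopic_sphere_normalize) (auto intro: hcm kcm dest: knz)
  hence "Brouwer_degree2 (Suc n) (\<lambda>x. sphere_normalize (Suc n) (h x))
      = Brouwer_degree2 (Suc n) (\<lambda>x. sphere_normalize (Suc n) (k x))"
    by (rule Brouwer_degree2_homotopic)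
  moreover have "Brouwer_degree2 (Suc n) (\<lambda>x. sphere_normalize (Suc n) (f x)) = Brouwer_degree2 (Suc n) f"
    using continuous_map_image_subset_topspace[OF f]
    by (intro Brouwer_degree2_eq sphere_normalize_id) auto
  ultimately have deg: "Brouwer_degree2 (Suc n) f = Brouwer_degree2 (Suc n) (\<lambda>x. sphere_normalize (Suc n) (k x))"
    by simp
  define s where "s = (\<lambda>x. sphere_normalize (Suc n) (k x))"
  have s: "continuous_map ?S ?S s"
    unfolding s_def using knz[where t = 1] by (intro continuous_map_sphere_normalize kcm) auto
  have odds: "s (- x) = - s x" for x by (simp add: s_def oddk sphere_normalize_uminus)
  have eq: "s x \<in> topspace (nsphere n)" if x: "x \<in> topspace (nsphere n)" for x
  proof -
    have "s x \<in> topspace ?S"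
      using continuous_map_image_subset_topspace[OF s] nsphere_mono[OF x] by auto
    moreover have "s x (Suc n) = 0"
      using x by (simp add: s_def sphere_normalize_def k_def topspace_nsphere)
    ultimately show ?thesis using topspace_nsphere_minus1[of "s x" "Suc n"] by simp
  qed
  have "continuous_map (nsphere n) (nsphere n) s"
    using continuous_map_nsphere_restrict[OF s] eq
    unfolding subtopology_nsphere_equator[of n, symmetric] continuous_map_in_subtopology
    by auto
  hence "odd (Brouwer_degree2 n s)" using odds by (intro Suc.IH)
  moreover have "even (Brouwer_degree2 (Suc n) s - Brouwer_degree2 (Suc n - Suc 0) s)"
  proof (rule Borsuk_odd_mapping_degree_step[OF s])
    show "(s \<circ> (\<lambda>x i. - x i)) u = ((\<lambda>x i. - x i) \<circ> s) u" for u
      using odds[of u] by (simp add: fun_Compl_def)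
    show "s \<in> topspace (nsphere (Suc n - Suc 0)) \<rightarrow> topspace (nsphere (Suc n - Suc 0))"
      using eq by auto
  qed
  ultimately show ?case unfolding deg s_def[symmetric] by simp
qed

text \<open>Without a common zero, normalization gives an odd map \<open>s\<close> into the equator.
  Its degree on the equator is odd, hence so is its degree on the sphere; but as a self-map of the
  sphere it misses the pole and has degree 0.\<close>

theorem Borsuk_Ulam:
  fixes f :: "(nat \<Rightarrow> real) \<Rightarrow> nat \<Rightarrow> real"
  assumes f: "\<And>i. i < n \<Longrightarrow> continuous_map (nsphere n) euclideanreal (\<lambda>x. f x i)"
    and odd: "\<And>x i. \<lbrakk>x \<in> topspace (nsphere n); i < n\<rbrakk> \<Longrightarrow> f (- x) i = - f x i"
  shows "\<exists>x\<in>topspace (nsphere n). \<forall>i<n. f x i = 0"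
proof (cases n)
  case 0
  thus ?thesis using in_topspace_nsphere by auto
next
  case (Suc k)
  show ?thesis
  proof (rule ccontr)
    assume "\<not> ?thesis"
    hence nz: "\<exists>i\<le>k. f x i \<noteq> 0" if "x \<in> topspace (nsphere n)" for x
      using that Suc by (metis less_Suc_eq_le)
    define s where "s = (\<lambda>x. sphere_normalize k (f x))"
    have sn: "continuous_map (nsphere n) (nsphere k) s"
      unfolding s_def using f nz Suc by (intro continuous_map_sphere_normalize) auto
    have odds: "s (- x) = - s x" if "x \<in> topspace (nsphere n)" for x
    proof -
      have "sphere_normalize k (f (- x)) = sphere_normalize k (- f x)"
        using odd[OF that] Suc by (auto simp: sphere_normalize_def fun_eq_iff)
      thus ?thesis by (simp add: s_def sphere_normalize_uminus)
    qed
    have im: "s x \<in> topspace (nsphere k)" if "x \<in> topspace (nsphere n)" for x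
      using continuous_map_image_subset_topspace[OF sn] that by auto
    have sk: "continuous_map (nsphere k) (nsphere k) s"
      using sn by (intro continuous_map_nsphere_restrict[of k]) (simp only: Suc)
    have s: "continuous_map (nsphere n) (nsphere n) s"
      using sn unfolding Suc subtopology_nsphere_equator[of k, symmetric] continuous_map_in_subtopology
      by auto
    have "odd (Brouwer_degree2 k s)"
      using sk odds nsphere_mono Suc by (intro odd_Brouwer_degree2) auto
    moreover have "even (Brouwer_degree2 n s - Brouwer_degree2 (n - Suc 0) s)"
    proof (rule Borsuk_odd_mapping_degree_step[OF s])
      show "(s \<circ> (\<lambda>x i. - x i)) u = ((\<lambda>x i. - x i) \<circ> s) u" if "u \<in> topspace (nsphere n)" for u
        using odds[OF that] by (simp add: fun_Compl_def)
      show "s \<in> topspace (nsphere (n - Suc 0)) \<rightarrow> topspace (nsphere (n - Suc 0))"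
        using im nsphere_mono Suc by auto
    qed
    moreover have "Brouwer_degree2 n s = 0"
    proof (rule Brouwer_degree2_nonsurjective[OF s])
      define u where "u = (\<lambda>i. if i = n then 1 else 0 :: real)"
      have "u \<in> topspace (nsphere n)"
        by (simp add: u_def topspace_nsphere if_distrib[of "\<lambda>x. x\<^sup>2"] cong: if_cong)
      moreover have "u \<notin> topspace (nsphere k)"
        using Suc by (auto simp: u_def topspace_nsphere)
      ultimately have "u \<in> topspace (nsphere n) - s ` topspace (nsphere n)"
        using im by (metis DiffI imageE)
      thus "s ` topspace (nsphere n) \<noteq> topspace (nsphere n)"
        by (metis DiffD1 DiffD2)
    qed
    ultimately show False by (simp add: Suc)
  qed
qed

subsection \<open>Interpolation\<close>

text \<open>Lagrange interpolation with greedily chosen nodes: each new function is interpolated at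
  the present nodes, and a point where the error \<open>r\<close> is nonzero, if there is one,
  becomes a further node.\<close>

lemma finite_interpolation:
  fixes b :: "'i \<Rightarrow> 'a \<Rightarrow> real"
  assumes "finite I"
  shows "\<exists>T L. finite T \<and> T \<subseteq> S \<and> (\<forall>s\<in>T. L s \<in> span (b ` I)) \<and>
    (\<forall>s\<in>T. \<forall>t\<in>T. L s t = (if s = t then 1 else 0)) \<and>
    (\<forall>i\<in>I. \<forall>t\<in>S. b i t = (\<Sum>s\<in>T. b i s * L s t))"
  using assms
proof (induction I)
  case empty
  show ?case by (intro exI[of _ "{}"]) simp
next
  case (insert k I)
  then obtain T L where T: "finite T" "T \<subseteq> S"
    and L: "\<forall>s\<in>T. L s \<in> span (b ` I)"
    and delta: "\<forall>s\<in>T. \<forall>t\<in>T. L s t = (if s = t then 1 else 0)"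
    and eq: "\<forall>i\<in>I. \<forall>t\<in>S. b i t = (\<Sum>s\<in>T. b i s * L s t)"
    by blast
  define r where "r = b k - (\<Sum>s\<in>T. b k s *\<^sub>R L s)"
  have r: "r t = b k t - (\<Sum>s\<in>T. b k s * L s t)" for t
    by (simp add: r_def sum_fun_apply scaleR_fun_apply)
  have Lk: "L s \<in> span (b ` insert k I)" if "s \<in> T" for s
    using L that span_mono[of "b ` I" "b ` insert k I"] by auto
  have r_span: "r \<in> span (b ` insert k I)"
    unfolding r_def by (intro span_diff span_sum span_scale Lk) (auto intro: span_base)
  show ?case
  proof (cases "\<forall>t\<in>S. r t = 0")
    case True
    hence "\<forall>i\<in>insert k I. \<forall>t\<in>S. b i t = (\<Sum>s\<in>T. b i s * L s t)"
      using eq by (simp add: r)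
    moreover have "\<forall>s\<in>T. L s \<in> span (b ` insert k I)" using Lk by blast
    ultimately show ?thesis using T delta by (intro exI[of _ T] exI[of _ L] conjI)
  next
    case False
    then obtain u where u: "u \<in> S" "r u \<noteq> 0" by blast
    have rT: "r t = 0" if "t \<in> T" for t
    proof -
      have "(\<Sum>s\<in>T. b k s * L s t) = (\<Sum>s\<in>T. if s = t then b k s else 0)"
        using delta that by (intro sum.cong) auto
      thus ?thesis using that T(1) by (simp add: r)
    qed
    with u have uT: "u \<notin> T" by blast
    \<comment> \<open>\<open>r\<close> vanishes at the old nodes but not at \<open>u\<close>, so its
      multiple \<open>l\<close> is the Lagrange function of \<open>u\<close>; subtracting multiples
      of \<open>l\<close> makes the old Lagrange functions vanish at \<open>u\<close>.\<close>
    define l where "l = (1 / r u) *\<^sub>R r"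
    have l: "l t = r t / r u" for t by (simp add: l_def scaleR_fun_apply)
    define L' where "L' = (\<lambda>s. if s = u then l else L s - L s u *\<^sub>R l)"
    have L'u: "L' u = l" and L'T: "\<And>s t. s \<in> T \<Longrightarrow> L' s t = L s t - L s u * l t"
      using uT by (auto simp: L'_def scaleR_fun_apply)
    have l_span: "l \<in> span (b ` insert k I)" unfolding l_def by (intro span_scale r_span)
    have "\<forall>s\<in>insert u T. L' s \<in> span (b ` insert k I)"
    proof
      fix s assume s: "s \<in> insert u T"
      show "L' s \<in> span (b ` insert k I)"
      proof (cases "s = u")
        case False
        with s have "s \<in> T" by simp
        hence "L s - L s u *\<^sub>R l \<in> span (b ` insert k I)"
          by (intro span_diff span_scale l_span Lk)
        with False show ?thesis by (simp only: L'_def if_False)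
      qed (simp only: L'u l_span)
    qed
    moreover have "\<forall>s\<in>insert u T. \<forall>t\<in>insert u T. L' s t = (if s = t then 1 else 0)"
      using delta rT u uT by (auto simp: L'u L'T l)
    moreover have "\<forall>i\<in>insert k I. \<forall>t\<in>S. b i t = (\<Sum>s\<in>insert u T. b i s * L' s t)"
    proof (intro ballI)
      fix i t assume i: "i \<in> insert k I" and t: "t \<in> S"
      have "(\<Sum>s\<in>insert u T. b i s * L' s t) = b i u * l t + (\<Sum>s\<in>T. b i s * (L s t - L s u * l t))"
        using T(1) uT by (simp add: L'u L'T)
      \<comment> \<open>The coefficient of \<open>l\<close> is the old interpolation error of
        \<open>b i\<close> at \<open>u\<close>: it is 0 for \<open>i\<close> in \<open>I\<close>,
        and \<open>r u\<close> for \<open>i = k\<close>.\<close>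
      also have "\<dots> = (\<Sum>s\<in>T. b i s * L s t) + (b i u - (\<Sum>s\<in>T. b i s * L s u)) * l t"
        by (simp add: algebra_simps sum_subtractf sum_distrib_left)
      also have "\<dots> = b i t"
      proof (cases "i = k")
        case True
        have "(b k u - (\<Sum>s\<in>T. b k s * L s u)) * l t = r t"
          using u by (simp add: l flip: r)
        with True show ?thesis by (simp add: r)
      next
        case False
        with i have "i \<in> I" by simp
        with eq t u show ?thesis by simp
      qed
      finally show "b i t = (\<Sum>s\<in>insert u T. b i s * L' s t)" ..
    qed
    ultimately show ?thesis using T u
      by (intro exI[of _ "insert u T"] exI[of _ L'] conjI) simp_all
  qed
qed

lemma continuous_on_span:
  fixes B :: "('a::topological_space \<Rightarrow> real) set"
  assumes "\<And>f. f \<in> B \<Longrightarrow> continuous_on S f" "f \<in> span B"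
  shows "continuous_on S f"
proof -
  have "subspace {f :: 'a \<Rightarrow> real. continuous_on S f}"
    by (auto simp: subspace_def scaleR_fun_def func_zero func_plus intro!: continuous_intros)
  hence "span B \<subseteq> {f. continuous_on S f}"
    using assms(1) by (intro span_minimal) auto
  with assms(2) show ?thesis by blast
qed

text \<open>Extends from monomials by linearity. It serves twice: a polynomial vanishing on
  \<open>T\<close> vanishes on \<open>Rn n\<close>, and evaluation at a moving point reduces to
  evaluations at fixed nodes with continuous weights.\<close>

lemma polynomial_interpolation:
  "\<exists>T L. finite T \<and> T \<subseteq> Rn n \<and> (\<forall>s\<in>T. continuous_on UNIV (L s)) \<and>
    (\<forall>p t. polynomial_on d n (Rn n) p \<and> t \<in> Rn n \<longrightarrow> p t = (\<Sum>s\<in>T. p s * L s t))"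
proof -
  define b where "b = (\<lambda>\<alpha> t. \<Prod>i<n. t i ^ \<alpha> i :: real)"
  obtain T L where T: "finite T" "T \<subseteq> Rn n" and L: "\<forall>s\<in>T. L s \<in> span (b ` multi_indices d n)"
    and eq: "\<forall>i\<in>multi_indices d n. \<forall>t\<in>Rn n. b i t = (\<Sum>s\<in>T. b i s * L s t)"
    using finite_interpolation[OF finite_multi_indices[of d n], of "Rn n" b] by blast
  have "continuous_on UNIV (L s)" if "s \<in> T" for s
  proof (rule continuous_on_span)
    show "L s \<in> span (b ` multi_indices d n)" using L that by blast
    show "continuous_on UNIV f" if "f \<in> b ` multi_indices d n" for f
      using that by (auto simp: b_def intro!: continuous_intros continuous_on_product_coordinates)
  qed
  moreover have "p t = (\<Sum>s\<in>T. p s * L s t)" if p: "polynomial_on d n (Rn n) p" and t: "t \<in> Rn n" for p t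
  proof -
    obtain c where c: "\<And>x. x \<in> Rn n \<Longrightarrow> p x = (\<Sum>\<alpha>\<in>multi_indices d n. c \<alpha> * b \<alpha> x)"
      using p by (auto simp: polynomial_on_def b_def)
    have "(\<Sum>s\<in>T. p s * L s t) = (\<Sum>s\<in>T. \<Sum>\<alpha>\<in>multi_indices d n. c \<alpha> * (b \<alpha> s * L s t))"
      using T(2) by (intro sum.cong refl) (auto simp: c sum_distrib_right mult.assoc subset_iff simp del: topspace_Euclidean_space)
    also have "\<dots> = (\<Sum>\<alpha>\<in>multi_indices d n. c \<alpha> * (\<Sum>s\<in>T. b \<alpha> s * L s t))"
      by (subst sum.swap) (simp add: sum_distrib_left)
    also have "\<dots> = p t" using eq t by (simp add: c)
    finally show ?thesis ..
  qed
  ultimately show ?thesis using T by (intro exI[of _ T] exI[of _ L] conjI) blast+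
qed

subsection \<open>Evaluation at orthogonal projections is continuous on the bundle\<close>

definition ip :: "nat \<Rightarrow> (nat \<Rightarrow> real) \<Rightarrow> (nat \<Rightarrow> real) \<Rightarrow> real"
  where "ip N x y = (\<Sum>k<N. x k * y k)"

lemma ip_commute: "ip N x y = ip N y x"
  by (simp add: ip_def mult.commute)

lemma ip_diff_left: "ip N (x - y) z = ip N x z - ip N y z"
  by (simp add: ip_def left_diff_distrib sum_subtractf)

lemma ip_scaleR_left: "ip N (r *\<^sub>R x) z = r * ip N x z"
  by (simp add: ip_def scaleR_fun_apply sum_distrib_left mult.assoc)

lemma ip_sum_left: "ip N (\<Sum>i\<in>A. f i) z = (\<Sum>i\<in>A. ip N (f i) z)"
  unfolding ip_def sum_fun_apply sum_distrib_right by (rule sum.swap)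

lemma ip_frame_map_left: "ip N (frame_map n v t) z = (\<Sum>i<n. t i * ip N (v i) z)"
  by (simp add: frame_map_def ip_sum_left ip_scaleR_left)

lemma ip_self_eq_0:
  assumes "x \<in> Rn N" "ip N x x = 0"
  shows "x = 0"
proof
  fix i
  have "\<forall>k<N. x k * x k = 0"
    using assms(2) unfolding ip_def by (subst (asm) sum_nonneg_eq_0_iff) auto
  thus "x i = 0 i" using assms(1) by (cases "i < N") (auto simp: topspace_Euclidean_space)
qed

lemma frame_span_eq_image: "v \<in> frames n N \<Longrightarrow> frame_span n v = frame_map n v ` Rn n"
  using bij_betw_frame_map by (metis bij_betw_imp_surj_on)

lemma orthogonal_frame_span:
  assumes "v \<in> frames n N" "\<And>j. j < n \<Longrightarrow> ip N r (v j) = 0" "z \<in> frame_span n v"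
  shows "ip N r z = 0"
proof -
  obtain t where "z = frame_map n v t" using assms(1,3) by (auto simp: frame_span_eq_image)
  thus ?thesis
    using assms(2) by (simp add: ip_commute[of N r] ip_frame_map_left)
qed

lemma continuous_map_stiefel_coordinate:
  assumes "j < n"
  shows "continuous_map (stiefel n N) euclideanreal (\<lambda>v. v j i)"
proof -
  have "continuous_map (stiefel n N) (Euclidean_space N) (\<lambda>v. v j)"
    unfolding stiefel_def using assms
    by (intro continuous_map_from_subtopology continuous_map_product_projection) simp
  moreover have "continuous_map (Euclidean_space N) euclideanreal (\<lambda>x. x i)"
    unfolding Euclidean_space_def
    by (intro continuous_map_from_subtopology continuous_map_product_projection) simp
  ultimately show ?thesis
    using continuous_map_compose[of _ _ "\<lambda>v. v j" _ "\<lambda>x. x i"] by (simp add: o_def)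
qed

lemma frame_map_in_Rn:
  assumes "v \<in> frames n N" "t \<in> Rn n"
  shows "frame_map n v t \<in> Rn N"
  using assms frame_span_in_subspaces[OF assms(1)]
  unfolding subspaces_def frame_span_eq_image[OF assms(1)] by blast

lemma continuous_map_frame_map_coordinate:
  assumes "\<And>j. j < n \<Longrightarrow> continuous_map (stiefel n N) euclideanreal (\<lambda>v. t v j)"
  shows "continuous_map (stiefel n N) euclideanreal (\<lambda>v. frame_map n v (t v) i)"
  unfolding frame_map_def sum_fun_apply scaleR_fun_apply real_scaleR_def
  by (intro continuous_map_sum continuous_map_real_mult assms continuous_map_stiefel_coordinate) auto

lemma continuous_map_ip:
  assumes "\<And>i. continuous_map X euclideanreal (\<lambda>v. f v i)" "\<And>i. continuous_map X euclideanreal (\<lambda>v. g v i)"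
  shows "continuous_map X euclideanreal (\<lambda>v. ip N (f v) (g v))"
  unfolding ip_def by (intro continuous_map_sum continuous_map_real_mult assms) auto

text \<open>One Gram-Schmidt step per index \<open>k\<close>.  The vector \<open>y\<close> may depend on the frame because the
  step also projects \<open>v k\<close> itself onto the span of its predecessors.\<close>

lemma continuous_projection_coordinates:
  assumes "k \<le> n" "\<And>i. continuous_map (stiefel n N) euclideanreal (\<lambda>v. y v i)"
  shows "\<exists>\<tau>. (\<forall>i. continuous_map (stiefel n N) euclideanreal (\<lambda>v. \<tau> v i)) \<and>
    (\<forall>v\<in>frames n N. (\<forall>i\<ge>k. \<tau> v i = 0) \<and> (\<forall>j<k. ip N (y v - frame_map n v (\<tau> v)) (v j) = 0))"
  using assms
proof (induction k arbitrary: y)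
  case 0
  show ?case by (intro exI[of _ "\<lambda>_ _. 0"]) simp
next
  case (Suc k)
  have k: "k < n" "k \<le> n" using Suc.prems(1) by auto
  obtain \<sigma> where \<sigma>: "\<And>i. continuous_map (stiefel n N) euclideanreal (\<lambda>v. \<sigma> v i)"
      "\<And>v i. v \<in> frames n N \<Longrightarrow> i \<ge> k \<Longrightarrow> \<sigma> v i = 0"
      "\<And>v j. v \<in> frames n N \<Longrightarrow> j < k \<Longrightarrow> ip N (y v - frame_map n v (\<sigma> v)) (v j) = 0"
    using Suc.IH[of y, OF k(2) Suc.prems(2)] by blast
  obtain \<rho> where \<rho>: "\<And>i. continuous_map (stiefel n N) euclideanreal (\<lambda>v. \<rho> v i)"
      "\<And>v i. v \<in> frames n N \<Longrightarrow> i \<ge> k \<Longrightarrow> \<rho> v i = 0"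
      "\<And>v j. v \<in> frames n N \<Longrightarrow> j < k \<Longrightarrow> ip N (v k - frame_map n v (\<rho> v)) (v j) = 0"
    using Suc.IH[of "\<lambda>v. v k", OF k(2) continuous_map_stiefel_coordinate[OF k(1)]] by blast
  \<comment> \<open>\<open>u v\<close> is \<open>v k\<close> minus its projection to the span of the
    preceding vectors, and \<open>w v\<close> holds its coordinates in the frame. Adding
    \<open>a v\<close> times \<open>u v\<close> to the previous projection of \<open>y\<close> makes
    the residual orthogonal to \<open>u v\<close> as well.\<close>
  define w where "w = (\<lambda>v. unit_vec k - \<rho> v)"
  define u where "u = (\<lambda>v. frame_map n v (w v))"
  define a where "a = (\<lambda>v. ip N (y v) (u v) / ip N (u v) (u v))"
  define \<tau> where "\<tau> = (\<lambda>v. \<sigma> v + a v *\<^sub>R w v)"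
  have fm_unit: "frame_map n v (unit_vec k) = v k" for v
  proof -
    have "frame_map n v (unit_vec k) = (\<Sum>j<n. if j = k then v j else 0)"
      unfolding frame_map_def by (intro sum.cong) (auto simp: unit_vec_def)
    with k show ?thesis by simp
  qed
  have u: "u v = v k - frame_map n v (\<rho> v)" for v
    by (simp add: u_def w_def linear_diff[OF linear_frame_map] fm_unit)
  have wc: "continuous_map (stiefel n N) euclideanreal (\<lambda>v. w v i)" for i
    by (auto simp: w_def intro!: continuous_map_diff \<rho>)
  have uc: "continuous_map (stiefel n N) euclideanreal (\<lambda>v. u v i)" for i
    unfolding u_def by (intro continuous_map_frame_map_coordinate wc)
  \<comment> \<open>Coordinate \<open>k\<close> of \<open>w v\<close> is 1, so injectivity of the
    frame map excludes \<open>u v = 0\<close>.\<close>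
  have uu: "ip N (u v) (u v) \<noteq> 0" if v: "v \<in> frames n N" for v
  proof
    assume 0: "ip N (u v) (u v) = 0"
    have w: "w v \<in> Rn n" using \<rho>(2)[OF v] k by (simp add: w_def unit_vec_def topspace_Euclidean_space)
    have "u v = 0" using frame_map_in_Rn[OF v w] 0 by (intro ip_self_eq_0) (simp_all add: u_def)
    hence "frame_map n v (w v) = frame_map n v 0"
      by (simp add: u_def linear_0[OF linear_frame_map])
    hence "w v = 0"
      using bij_betw_imp_inj_on[OF bij_betw_frame_map[OF v]] w subspace_0[OF subspace_Rn] by (meson inj_onD)
    hence "w v k = 0" by simp
    thus False using \<rho>(2)[OF v, of k] by (simp add: w_def unit_vec_def)
  qed
  have "continuous_map (stiefel n N) euclideanreal a"
    unfolding a_def using uu by (intro continuous_map_real_divide continuous_map_ip uc Suc.prems(2)) (simp add: topspace_stiefel)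
  hence "continuous_map (stiefel n N) euclideanreal (\<lambda>v. \<tau> v i)" for i
    unfolding \<tau>_def by (simp add: scaleR_fun_apply) (intro continuous_map_add continuous_map_real_mult \<sigma> wc)
  moreover have "\<tau> v i = 0" if "v \<in> frames n N" "i \<ge> Suc k" for v i
    using that \<sigma>(2) \<rho>(2) by (simp add: \<tau>_def w_def unit_vec_def scaleR_fun_apply)
  moreover have "ip N (y v - frame_map n v (\<tau> v)) (v j) = 0" if v: "v \<in> frames n N" and "j < Suc k" for v j
  proof -
    let ?r = "y v - frame_map n v (\<tau> v)"
    have r: "?r = (y v - frame_map n v (\<sigma> v)) - a v *\<^sub>R u v"
      by (simp add: \<tau>_def u_def linear_add[OF linear_frame_map] linear_scale[OF linear_frame_map])
    have lt: "ip N ?r (v j) = 0" if "j < k" for j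
      unfolding r ip_diff_left[of N _ "a v *\<^sub>R u v"] ip_scaleR_left
      using \<sigma>(3)[OF v that] \<rho>(3)[OF v that] by (simp add: u)
    have low: "ip N (frame_map n v t) z = 0"
      if "\<And>i. i \<ge> k \<Longrightarrow> t i = 0" "\<And>j. j < k \<Longrightarrow> ip N (v j) z = 0" for t z
      unfolding ip_frame_map_left using that by (intro sum.neutral ballI) (metis mult_eq_0_iff not_le)
    have \<sigma>u: "ip N (frame_map n v (\<sigma> v)) (u v) = 0"
      using \<sigma>(2)[OF v] \<rho>(3)[OF v] by (intro low) (auto simp: u ip_commute)
    \<comment> \<open>The residual is orthogonal to \<open>u v\<close> and to the predecessors of
      \<open>v k\<close>, hence to \<open>v k\<close>, which differs from \<open>u v\<close> by a
      combination of these predecessors.\<close>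
    have "ip N ?r (u v) = 0"
      unfolding r ip_diff_left ip_scaleR_left \<sigma>u using uu[OF v] by (simp add: a_def)
    moreover have "ip N (frame_map n v (\<rho> v)) ?r = 0"
      using \<rho>(2)[OF v] lt by (intro low) (auto simp: ip_commute)
    moreover have "ip N (v k) ?r = ip N (u v) ?r + ip N (frame_map n v (\<rho> v)) ?r"
      by (simp add: u ip_diff_left)
    ultimately have "ip N ?r (v k) = 0" by (simp add: ip_commute)
    with lt \<open>j < Suc k\<close> show ?thesis by (cases "j = k") auto
  qed
  ultimately show ?case by blast
qed

text \<open>Defined from \<open>V\<close> without a frame, so that evaluation at the projection of a
  fixed point is a function on the total space of the bundle.\<close>

definition orthogonal_projection :: "nat \<Rightarrow> (nat \<Rightarrow> real) set \<Rightarrow> (nat \<Rightarrow> real) \<Rightarrow> nat \<Rightarrow> real"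
  where "orthogonal_projection N V y = (THE w. w \<in> V \<and> (\<forall>z\<in>V. ip N (y - w) z = 0))"

text \<open>Two candidates differ by a vector of \<open>V\<close> that is orthogonal to
  \<open>V\<close>, hence to itself.\<close>

lemma orthogonal_projection_eqI:
  assumes V: "subspace V" "V \<subseteq> Rn N" and w: "w \<in> V" "\<And>z. z \<in> V \<Longrightarrow> ip N (y - w) z = 0"
  shows "orthogonal_projection N V y = w"
  unfolding orthogonal_projection_def
proof (rule the_equality)
  show "w \<in> V \<and> (\<forall>z\<in>V. ip N (y - w) z = 0)" using w by blast
  fix w' assume w': "w' \<in> V \<and> (\<forall>z\<in>V. ip N (y - w') z = 0)"
  have "w' - w \<in> V" using w w' V by (simp add: subspace_diff)
  moreover from this have "ip N ((y - w) - (y - w')) (w' - w) = 0"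
    using w w' by (simp only: ip_diff_left[of N "y - w"])
  hence "ip N (w' - w) (w' - w) = 0" by simp
  ultimately have "w' - w = 0" using V(2) by (intro ip_self_eq_0[of _ N]) auto
  thus "w' = w" by simp
qed

lemma continuous_map_into_euclidean_fun:
  fixes f :: "'a \<Rightarrow> nat \<Rightarrow> real"
  assumes "\<And>i. continuous_map X euclideanreal (\<lambda>x. f x i)"
  shows "continuous_map X euclidean f"
  using assms by (simp add: continuous_map_componentwise_UNIV flip: euclidean_product_topology)

text \<open>The bundle is a quotient, so continuity is checked on pairs of a frame \<open>v\<close>
  and a polynomial \<open>q\<close>, where the value is \<open>q (\<tau> v)\<close>. Both vary, and
  the pointwise topology controls \<open>q\<close> only at fixed points; interpolation turns the
  value into a sum of products of \<open>q s\<close> and continuous functions of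
  \<open>v\<close>.\<close>

lemma continuous_map_evaluate_at_projection:
  "continuous_map (odd_polynomial_bundle d n N) euclideanreal
     (\<lambda>(V, f). f (orthogonal_projection N V y))"
proof -
  let ?X = "prod_topology (stiefel n N) (odd_polynomial_topology d n)"
  obtain T L where T: "T \<subseteq> Rn n" "finite T" and L: "\<And>s. s \<in> T \<Longrightarrow> continuous_on UNIV (L s)"
    and p: "\<And>p t. \<lbrakk>polynomial_on d n (Rn n) p; t \<in> Rn n\<rbrakk> \<Longrightarrow> p t = (\<Sum>s\<in>T. p s * L s t)"
    using polynomial_interpolation[of n d] by blast
  have y: "continuous_map (stiefel n N) euclideanreal (\<lambda>_. y i)" for i by simp
  obtain \<tau> where \<tau>: "\<And>i. continuous_map (stiefel n N) euclideanreal (\<lambda>v. \<tau> v i)"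
      "\<And>v i. v \<in> frames n N \<Longrightarrow> i \<ge> n \<Longrightarrow> \<tau> v i = 0"
      "\<And>v j. v \<in> frames n N \<Longrightarrow> j < n \<Longrightarrow> ip N (y - frame_map n v (\<tau> v)) (v j) = 0"
    using continuous_projection_coordinates[of n n N "\<lambda>_. y", OF order_refl y] by blast
  have \<tau>_Rn: "\<tau> v \<in> Rn n" if "v \<in> frames n N" for v
    using \<tau>(2)[OF that] by (simp add: topspace_Euclidean_space)
  have snd: "continuous_map ?X euclideanreal (\<lambda>z. snd z s)" if "s \<in> T" for s
  proof -
    have "continuous_map (odd_polynomial_topology d n) euclideanreal (\<lambda>p. p s)"
      unfolding odd_polynomial_topology_def using T that
      by (intro continuous_map_from_subtopology continuous_map_product_projection) blast
    from continuous_map_compose[OF continuous_map_snd this] show ?thesis by (simp add: o_def)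
  qed
  have fst: "continuous_map ?X euclideanreal (\<lambda>z. L s (\<tau> (fst z)))" if "s \<in> T" for s
  proof -
    have "continuous_map ?X euclidean (\<lambda>z. \<tau> (fst z))"
      using continuous_map_compose[OF continuous_map_fst continuous_map_into_euclidean_fun[OF \<tau>(1)]]
      by (simp add: o_def)
    from continuous_map_compose[OF this, of euclideanreal "L s"] L[OF that] show ?thesis by (simp add: o_def)
  qed
  have "continuous_map ?X euclideanreal (\<lambda>z. \<Sum>s\<in>T. snd z s * L s (\<tau> (fst z)))"
    by (intro continuous_map_sum continuous_map_real_mult snd fst T)
  moreover have "(\<Sum>s\<in>T. snd z s * L s (\<tau> (fst z))) =
      ((\<lambda>(V, f). f (orthogonal_projection N V y)) \<circ> frame_transport n) z" if "z \<in> topspace ?X" for z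
  proof -
    obtain v q where z: "z = (v, q)" by (cases z)
    have v: "v \<in> frames n N" and q: "q \<in> odd_polynomials d n (Rn n)"
      using that by (simp_all add: z topspace_stiefel topspace_odd_polynomial_topology)
    let ?V = "frame_span n v"
    have V: "?V \<in> subspaces n N" by (rule frame_span_in_subspaces[OF v])
    have mem: "frame_map n v (\<tau> v) \<in> ?V" using \<tau>_Rn[OF v] by (simp only: frame_span_eq_image[OF v]) blast
    have "orthogonal_projection N ?V y = frame_map n v (\<tau> v)"
      using V mem orthogonal_frame_span[OF v \<tau>(3)[OF v]]
      by (intro orthogonal_projection_eqI) (auto simp: subspaces_def)
    moreover have "inv_into (Rn n) (frame_map n v) (frame_map n v (\<tau> v)) = \<tau> v"
      using bij_betw_imp_inj_on[OF bij_betw_frame_map[OF v]] \<tau>_Rn[OF v] by (rule inv_into_f_f)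
    ultimately have "((\<lambda>(V, f). f (orthogonal_projection N V y)) \<circ> frame_transport n) z = q (\<tau> v)"
      using mem by (simp add: z frame_transport_def)
    thus ?thesis using p[of q "\<tau> v"] q \<tau>_Rn[OF v] by (simp add: z odd_polynomials_def)
  qed
  ultimately have "continuous_map ?X euclideanreal
      ((\<lambda>(V, f). f (orthogonal_projection N V y)) \<circ> frame_transport n)"
    by (rule continuous_map_eq)
  thus ?thesis
    unfolding odd_polynomial_bundle_def
    by (rule continuous_compose_quotient_map[OF quotient_map_quotient_topology])
qed

subsection \<open>The subspaces spanned by block frames\<close>

text \<open>The copies of \<open>x\<close> occupy consecutive blocks of \<open>M\<close>
  coordinates. The bounded abstraction makes the family extensional, as \<open>frames\<close>
  demands.\<close>

definition block_frame :: "nat \<Rightarrow> nat \<Rightarrow> (nat \<Rightarrow> real) \<Rightarrow> nat \<Rightarrow> nat \<Rightarrow> real"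
  where "block_frame n M x = (\<lambda>i\<in>{..<n}. \<lambda>k. if k div M = i then x (k mod M) else 0)"

lemma ip_block_frame:
  assumes "i < n" "j < n"
  shows "ip (n * M) (block_frame n M x i) (block_frame n M y j) = (if i = j then ip M x y else 0)"
proof (cases "i = j")
  case True
  have "ip (n * M) (block_frame n M x i) (block_frame n M y j)
      = (\<Sum>k<n * M. if k div M = i then x (k mod M) * y (k mod M) else 0)"
    unfolding ip_def using assms True by (intro sum.cong) (auto simp: block_frame_def)
  also have "\<dots> = (\<Sum>k\<in>{k\<in>{..<n * M}. k div M = i}. x (k mod M) * y (k mod M))"
    by (rule sum.inter_filter[symmetric]) simp
  also have "\<dots> = (\<Sum>l<M. x l * y l)"
  proof (rule sum.reindex_bij_witness[of _ "\<lambda>l. i * M + l" "\<lambda>k. k mod M"])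
    fix l assume "l \<in> {..<M}"
    moreover have "i * M + l < n * M" if "l < M"
    proof -
      have "i * M + l < Suc i * M" using that by simp
      also have "\<dots> \<le> n * M" using assms by (intro mult_right_mono) auto
      finally show ?thesis .
    qed
    ultimately show "i * M + l \<in> {k \<in> {..<n * M}. k div M = i}" by simp
  next
    fix k assume "k \<in> {k \<in> {..<n * M}. k div M = i}"
    thus "i * M + k mod M = k" "k mod M \<in> {..<M}"
      by (auto simp: mult.commute intro!: mod_less_divisor gr0I)
  qed auto
  finally show ?thesis using True by (simp add: ip_def)
next
  case False
  with assms show ?thesis
    unfolding ip_def by (auto simp: block_frame_def intro!: sum.neutral)
qed

lemma ip_nsphere:
  assumes "x \<in> topspace (nsphere m)"
  shows "ip (Suc m) x x = 1"
  using assms unfolding ip_def topspace_nsphere lessThan_Suc_atMost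
  by (simp add: power2_eq_square)

text \<open>The copies of a unit vector are orthonormal, so pairing a linear relation with one of
  them extracts its coefficient.\<close>

lemma block_frame_in_frames:
  assumes "ip M x x = 1"
  shows "block_frame n M x \<in> frames n (n * M)"
proof -
  let ?v = "block_frame n M x"
  have v: "ip (n * M) (?v i) (?v j) = (if i = j then 1 else 0)" if "i < n" "j < n" for i j
    using that assms by (simp add: ip_block_frame)
  have inj: "inj_on ?v {..<n}"
  proof (rule inj_onI)
    fix i j assume "i \<in> {..<n}" "j \<in> {..<n}" "?v i = ?v j"
    thus "i = j" using v[of i i] v[of i j] by (auto split: if_splits)
  qed
  moreover have "independent (?v ` {..<n})"
  proof (rule independent_if_scalars_zero)
    fix f w assume f: "(\<Sum>w\<in>?v ` {..<n}. f w *\<^sub>R w) = 0" and w: "w \<in> ?v ` {..<n}"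
    obtain j where j: "j < n" "w = ?v j" using w by auto
    have "0 = ip (n * M) (\<Sum>i<n. f (?v i) *\<^sub>R ?v i) (?v j)"
      using f inj by (simp add: sum.reindex ip_def)
    also have "\<dots> = (\<Sum>i<n. if i = j then f (?v i) else 0)"
      unfolding ip_sum_left ip_scaleR_left using v j by (intro sum.cong) auto
    also have "\<dots> = f w" using j by simp
    finally show "f w = 0" ..
  qed simp
  moreover have "?v \<in> {..<n} \<rightarrow>\<^sub>E Rn (n * M)"
  proof (rule PiE_I)
    fix i assume i: "i \<in> {..<n}"
    have "k div M \<noteq> i" if "k \<ge> n * M" for k
    proof
      assume "k div M = i"
      with i have "k div M < n" by simp
      moreover have "M > 0" using assms by (cases M) (auto simp: ip_def)
      ultimately have "k < n * M" by (simp add: div_less_iff_less_mult)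
      with that show False by simp
    qed
    with i show "?v i \<in> Rn (n * M)" by (simp add: block_frame_def topspace_Euclidean_space)
  qed (simp add: block_frame_def)
  ultimately show ?thesis by (simp add: frames_def)
qed

lemma continuous_map_block_frame:
  "continuous_map (nsphere m) (stiefel n (n * Suc m)) (block_frame n (Suc m))"
proof -
  have coord: "continuous_map (nsphere m) (Euclidean_space (n * Suc m)) (\<lambda>x. block_frame n (Suc m) x i)"
    if i: "i < n" for i
  proof -
    have "continuous_map (nsphere m) (powertop_real UNIV) (\<lambda>x. block_frame n (Suc m) x i)"
      unfolding continuous_map_componentwise_UNIV
    proof
      fix k
      show "continuous_map (nsphere m) euclideanreal (\<lambda>x. block_frame n (Suc m) x i k)"
        using i by (cases "k div Suc m = i") (simp_all add: block_frame_def continuous_map_nsphere_projection)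
    qed
    moreover have "block_frame n (Suc m) x i \<in> Rn (n * Suc m)" if "x \<in> topspace (nsphere m)" for x
      using block_frame_in_frames[OF ip_nsphere[OF that], of n] i unfolding frames_def by blast
    ultimately show ?thesis
      unfolding Euclidean_space_def continuous_map_in_subtopology by (auto simp: topspace_Euclidean_space)
  qed
  show ?thesis
    unfolding stiefel_def continuous_map_in_subtopology continuous_map_componentwise
  proof (intro conjI ballI)
    show "block_frame n (Suc m) ` topspace (nsphere m) \<subseteq> extensional {..<n}"
      by (rule image_subsetI) (simp add: block_frame_def)
    show "continuous_map (nsphere m) (Euclidean_space (n * Suc m)) (\<lambda>x. block_frame n (Suc m) x i)"
      if "i \<in> {..<n}" for i
      using that by (intro coord) simp
    show "block_frame n (Suc m) \<in> topspace (nsphere m) \<rightarrow> frames n (n * Suc m)"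
      by (intro Pi_I block_frame_in_frames ip_nsphere)
  qed
qed

lemma continuous_map_grassmannian_block_frame:
  "continuous_map (nsphere m) (grassmannian n (n * Suc m)) (\<lambda>x. frame_span n (block_frame n (Suc m) x))"
proof -
  have "continuous_map (stiefel n (n * Suc m)) (grassmannian n (n * Suc m)) (frame_span n)"
    unfolding grassmannian_def
    by (rule quotient_imp_continuous_map[OF quotient_map_quotient_topology])
  from continuous_map_compose[OF continuous_map_block_frame this]
  show ?thesis by (simp only: o_def)
qed

lemma frame_map_block_frame_uminus:
  "frame_map n (block_frame n M (- x)) t = - frame_map n (block_frame n M x) t"
proof -
  have "block_frame n M (- x) i = - block_frame n M x i" if "i < n" for i
    using that by (auto simp: block_frame_def)
  thus ?thesis by (simp add: frame_map_def sum_negf)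
qed

text \<open>Different blocks are orthogonal, so the projection acts block by block: in each of them
  it replaces \<open>z\<close> by \<open>ip M z x\<close> times \<open>x\<close>, its projection to
  the line of the unit vector \<open>x\<close>.\<close>

lemma projection_block_frame:
  assumes x: "ip M x x = 1" and s: "s \<in> Rn n"
  shows "orthogonal_projection (n * M) (frame_span n (block_frame n M x))
      (frame_map n (block_frame n M z) s)
    = frame_map n (block_frame n M x) (ip M z x *\<^sub>R s)"
proof -
  let ?v = "block_frame n M x" and ?u = "block_frame n M z"
  have v: "?v \<in> frames n (n * M)" by (rule block_frame_in_frames[OF x])
  have "ip (n * M) (frame_map n ?u s - frame_map n ?v (ip M z x *\<^sub>R s)) (?v j) = 0" if "j < n" for j
  proof -
    have "ip (n * M) (frame_map n w t) (?v j) = t j * ip M y x"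
      if "w = block_frame n M y" for w t y
    proof -
      have "ip (n * M) (frame_map n w t) (?v j) = (\<Sum>i<n. if i = j then t i * ip M y x else 0)"
        unfolding ip_frame_map_left using \<open>j < n\<close> that by (intro sum.cong) (auto simp: ip_block_frame)
      with \<open>j < n\<close> show ?thesis by simp
    qed
    from this[of ?u z s] this[of ?v x "ip M z x *\<^sub>R s"] show ?thesis
      by (simp add: ip_diff_left x scaleR_fun_apply)
  qed
  moreover have "ip M z x *\<^sub>R s \<in> Rn n" using s by (rule subspace_scale[OF subspace_Rn])
  hence "frame_map n ?v (ip M z x *\<^sub>R s) \<in> frame_span n ?v"
    unfolding frame_span_eq_image[OF v] by blast
  ultimately show ?thesis
    using frame_span_in_subspaces[OF v] orthogonal_frame_span[OF v]
    by (intro orthogonal_projection_eqI) (auto simp: subspaces_def)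
qed

section \<open>Continuity of the family along the block subspaces\<close>

lemma polynomial_on_frame_map:
  assumes v: "v \<in> frames n N" and f: "polynomial_on d N (frame_span n v) f"
  shows "polynomial_on d n (Rn n) (\<lambda>t. f (frame_map n v t))"
proof (rule polynomial_on_linear_substitution[OF f])
  show "frame_map n v t \<in> frame_span n v" if "t \<in> Rn n" for t
    unfolding frame_span_eq_image[OF v] using that by (rule imageI)
  show "polynomial_on 1 n (Rn n) (\<lambda>t. frame_map n v t i)" for i
    by (rule polynomial_on_linear[OF linear_frame_map subset_refl])
qed

text \<open>Allows interpolation of a rescaled polynomial, whose values at the fixed nodes are
  values of \<open>p\<close> at rescaled nodes.\<close>

lemma polynomial_on_scale:
  assumes "polynomial_on d n (Rn n) p"
  shows "polynomial_on d n (Rn n) (\<lambda>t. p (r *\<^sub>R t))"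
  using assms
proof (rule polynomial_on_linear_substitution)
  show "r *\<^sub>R t \<in> Rn n" if "t \<in> Rn n" for t using that by (rule subspace_scale[OF subspace_Rn])
  show "polynomial_on 1 n (Rn n) (\<lambda>t. (r *\<^sub>R t) i)" if "i < n" for i
    unfolding scaleR_fun_apply real_scaleR_def using that
    by (intro polynomial_on_cmult polynomial_on_coordinate)
qed

text \<open>Near \<open>x = z\<close> the point \<open>frame_map n (block_frame n M x) t\<close> moves with \<open>x\<close>; it is reached by
  projecting fixed points to the moving subspace, which rescales coordinates by \<open>ip M z x\<close>.\<close>

lemma continuous_map_family_on_blocks:
  assumes M: "M = Suc m" and F: "continuous_odd_polynomial_family d n (n * M) F" and t: "t \<in> Rn n"
  shows "continuous_map (nsphere m) euclideanreal
    (\<lambda>x. F (frame_span n (block_frame n M x)) (frame_map n (block_frame n M x) t))"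
proof -
  let ?N = "n * M"
  have unit: "ip M x x = 1" if "x \<in> topspace (nsphere m)" for x
    using ip_nsphere[OF that] by (simp only: M)
  define V where "V = (\<lambda>x. frame_span n (block_frame n M x))"
  define p where "p = (\<lambda>x t. F (V x) (frame_map n (block_frame n M x) t))"
  obtain T L where T: "finite T" "T \<subseteq> Rn n" and L: "\<And>s. s \<in> T \<Longrightarrow> continuous_on UNIV (L s)"
    and interp: "\<And>p t. \<lbrakk>polynomial_on d n (Rn n) p; t \<in> Rn n\<rbrakk> \<Longrightarrow> p t = (\<Sum>s\<in>T. p s * L s t)"
    using polynomial_interpolation[of n d] by blast
  have frame: "block_frame n M x \<in> frames n ?N" if "x \<in> topspace (nsphere m)" for x
    by (rule block_frame_in_frames[OF unit[OF that]])
  have poly: "polynomial_on d n (Rn n) (p x)" if x: "x \<in> topspace (nsphere m)" for x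
    unfolding p_def
  proof (rule polynomial_on_frame_map[OF frame[OF x]])
    show "polynomial_on d ?N (frame_span n (block_frame n M x)) (F (V x))"
      using F frame_span_in_subspaces[OF frame[OF x]]
      by (simp add: continuous_odd_polynomial_family_def odd_polynomials_def V_def)
  qed
  have eval: "continuous_map (nsphere m) euclideanreal (\<lambda>x. F (V x) (orthogonal_projection ?N (V x) y))" for y
  proof -
    have "continuous_map (nsphere m) (odd_polynomial_bundle d n ?N) (\<lambda>x. (V x, F (V x)))"
      using continuous_map_compose[OF continuous_map_grassmannian_block_frame[of m n, folded M],
        of _ "\<lambda>V. (V, F V)"] F
      by (simp add: continuous_odd_polynomial_family_def V_def o_def)
    from continuous_map_compose[OF this continuous_map_evaluate_at_projection]
    show ?thesis by (simp add: o_def)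
  qed
  \<comment> \<open>On the open set \<open>U z\<close> the scaling factor \<open>ip M z x\<close>
    can be inverted. Each \<open>z\<close> of the sphere lies in its own \<open>U z\<close>, so
    these sets cover the sphere.\<close>
  define U where "U = (\<lambda>z. {x \<in> topspace (nsphere m). ip M z x \<in> - {0}})"
  have ip_cont: "continuous_map (nsphere m) euclideanreal (\<lambda>x. ip M z x)" for z
    by (intro continuous_map_ip continuous_map_nsphere_projection) simp
  have "continuous_map (nsphere m) euclideanreal (\<lambda>x. p x t)"
  proof (rule pasting_lemma[where I = "topspace (nsphere m)" and T = U and f = "\<lambda>_ x. p x t"])
    fix z
    show "openin (nsphere m) (U z)"
      unfolding U_def by (rule openin_continuous_map_preimage[OF ip_cont]) (auto simp flip: open_openin intro: open_Compl)
    let ?Y = "subtopology (nsphere m) (U z)"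
    have nz: "ip M z x \<noteq> 0" "x \<in> topspace (nsphere m)" if "x \<in> topspace ?Y" for x
      using that by (auto simp: U_def)
    have a: "continuous_map ?Y euclideanreal (\<lambda>x. p x (ip M z x *\<^sub>R s))" if "s \<in> T" for s
    proof -
      have "continuous_map ?Y euclideanreal
          (\<lambda>x. F (V x) (orthogonal_projection ?N (V x) (frame_map n (block_frame n M z) s)))"
        by (rule continuous_map_from_subtopology[OF eval])
      thus ?thesis
        by (rule continuous_map_eq)
          (use T(2) that nz(2) in \<open>auto simp: p_def V_def projection_block_frame unit subset_iff simp del: topspace_Euclidean_space\<close>)
    qed
    have b: "continuous_map ?Y euclideanreal (\<lambda>x. L s ((1 / ip M z x) *\<^sub>R t))" if "s \<in> T" for s
    proof -
      have "continuous_map ?Y euclidean (\<lambda>x. (1 / ip M z x) *\<^sub>R t)"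
        by (rule continuous_map_into_euclidean_fun, unfold scaleR_fun_apply real_scaleR_def)
          (intro continuous_map_real_mult continuous_map_real_divide
            continuous_map_from_subtopology[OF ip_cont], auto simp: U_def)
      from continuous_map_compose[OF this, of euclideanreal "L s"] L[OF that] show ?thesis
        by (simp add: o_def)
    qed
    \<comment> \<open>With \<open>r = ip M z x\<close>, the polynomial \<open>p x\<close> rescaled
      by \<open>r\<close> is interpolated at \<open>t / r\<close>. Its values at the nodes are
      evaluations at projections of fixed points, hence continuous by \<open>eval\<close>.\<close>
    have "continuous_map ?Y euclideanreal (\<lambda>x. \<Sum>s\<in>T. p x (ip M z x *\<^sub>R s) * L s ((1 / ip M z x) *\<^sub>R t))"
      by (intro continuous_map_sum continuous_map_real_mult a b T)
    thus "continuous_map ?Y euclideanreal (\<lambda>x. p x t)"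
    proof (rule continuous_map_eq)
      fix x assume x: "x \<in> topspace ?Y"
      have "(1 / ip M z x) *\<^sub>R t \<in> Rn n" using t by (rule subspace_scale[OF subspace_Rn])
      from interp[OF polynomial_on_scale[OF poly[OF nz(2)[OF x]]] this, of "ip M z x"]
      show "(\<Sum>s\<in>T. p x (ip M z x *\<^sub>R s) * L s ((1 / ip M z x) *\<^sub>R t)) = p x t"
        using nz(1)[OF x] by simp
    qed
  next
    fix x assume x: "x \<in> topspace (nsphere m)"
    show "\<exists>j. j \<in> topspace (nsphere m) \<and> x \<in> U j \<and> p x t = p x t"
      using x unit[OF x] by (intro exI[of _ x]) (simp add: U_def)
  qed simp
  thus ?thesis by (simp add: p_def V_def)
qed

text \<open>The witness is \<open>N = n * (m + 1)\<close>, where \<open>m\<close> is the number of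
  interpolation nodes for degree \<open>d\<close> on \<open>Rn n\<close>: one odd condition per
  node, on a sphere of dimension \<open>m\<close>.\<close>

theorem theorem6:
  fixes d n :: nat
  assumes "odd d" and "d > 0" and "n > 0"
  shows "\<exists>N. \<forall>F. continuous_odd_polynomial_family d n N F \<longrightarrow>
           (\<exists>V\<in>subspaces n N. \<forall>x\<in>V. F V x = 0)"
proof -
  obtain T L where T: "finite T" "T \<subseteq> Rn n"
    and interp: "\<And>p t. \<lbrakk>polynomial_on d n (Rn n) p; t \<in> Rn n\<rbrakk> \<Longrightarrow> p t = (\<Sum>s\<in>T. p s * L s t)"
    using polynomial_interpolation[of n d] by blast
  define m where "m = card T"
  obtain e where e: "bij_betw e {..<m} T"
    using ex_bij_betw_nat_finite[OF T(1)] by (auto simp: m_def atLeast0LessThan)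
  have eT: "e i \<in> Rn n" if "i < m" for i
    using bij_betwE[OF e] T(2) that by blast
  define M where "M = Suc m"
  let ?N = "n * M"
  have unit: "ip M x x = 1" if "x \<in> topspace (nsphere m)" for x
    using ip_nsphere[OF that] by (simp only: M_def)
  have "\<exists>V\<in>subspaces n ?N. \<forall>x\<in>V. F V x = 0" if F: "continuous_odd_polynomial_family d n ?N F" for F
  proof -
    define V where "V = (\<lambda>x. frame_span n (block_frame n M x))"
    define p where "p = (\<lambda>x t. F (V x) (frame_map n (block_frame n M x) t))"
    have frame: "block_frame n M x \<in> frames n ?N" if "x \<in> topspace (nsphere m)" for x
      by (rule block_frame_in_frames[OF unit[OF that]])
    have V: "V x \<in> subspaces n ?N" "V x = frame_map n (block_frame n M x) ` Rn n"
      if "x \<in> topspace (nsphere m)" for x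
      using frame_span_in_subspaces[OF frame[OF that]] frame_span_eq_image[OF frame[OF that]]
      by (simp_all add: V_def)
    have FV: "F (V x) \<in> odd_polynomials d ?N (V x)" if "x \<in> topspace (nsphere m)" for x
      using F V(1)[OF that] by (simp add: continuous_odd_polynomial_family_def)
    \<comment> \<open>\<open>V (- x)\<close> and \<open>V x\<close> coincide while the frame map
      changes sign, so oddness in \<open>x\<close> comes from oddness of \<open>F (V x)\<close> on
      \<open>V x\<close>.\<close>
    have odd: "p (- x) t = - p x t" if x: "x \<in> topspace (nsphere m)" and t: "t \<in> Rn n" for x t
    proof -
      have "V (- x) = uminus ` V x"
        unfolding V(2)[OF x] V(2)[OF uminus_in_nsphere[OF x]] image_image
        by (intro image_cong refl frame_map_block_frame_uminus)
      also have "\<dots> = V x"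
      proof
        have sub: "subspace (V x)" using V(1)[OF x] by (simp add: subspaces_def)
        show "uminus ` V x \<subseteq> V x" using subspace_neg[OF sub] by blast
        show "V x \<subseteq> uminus ` V x" using subspace_neg[OF sub] by (metis image_eqI minus_minus subsetI)
      qed
      finally have "V (- x) = V x" .
      moreover have "frame_map n (block_frame n M x) t \<in> V x" using t by (simp only: V(2)[OF x]) blast
      ultimately show ?thesis
        using FV[OF x] by (simp add: p_def frame_map_block_frame_uminus odd_polynomials_def)
    qed
    obtain x where x: "x \<in> topspace (nsphere m)" and zero: "\<And>i. i < m \<Longrightarrow> p x (e i) = 0"
    proof -
      have "\<exists>x\<in>topspace (nsphere m). \<forall>i<m. p x (e i) = 0"
      proof (rule Borsuk_Ulam)
        show "continuous_map (nsphere m) euclideanreal (\<lambda>x. p x (e i))" if "i < m" for i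
          unfolding p_def V_def by (rule continuous_map_family_on_blocks[OF M_def F eT[OF that]])
        show "p (- x) (e i) = - p x (e i)" if "x \<in> topspace (nsphere m)" "i < m" for x i
          using odd that eT by blast
      qed
      thus thesis using that by blast
    qed
    have pT: "p x s = 0" if "s \<in> T" for s
      using zero e that by (metis bij_betw_imp_surj_on imageE lessThan_iff)
    have "polynomial_on d n (Rn n) (p x)"
      unfolding p_def V_def using FV[OF x]
      by (intro polynomial_on_frame_map[OF frame[OF x]]) (simp add: odd_polynomials_def V_def)
    \<comment> \<open>Vanishing at the nodes makes \<open>p x\<close> vanish on \<open>Rn n\<close>,
      and the frame map is onto \<open>V x\<close>.\<close>
    hence "p x t = 0" if "t \<in> Rn n" for t
      using interp[of "p x" t] that pT by simp
    hence "\<forall>y\<in>V x. F (V x) y = 0" by (auto simp: V(2)[OF x] p_def simp del: topspace_Euclidean_space)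
    with V(1)[OF x] show ?thesis by blast
  qed
  thus ?thesis by blast
qed

end
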